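(* Let $M$ be an even Coxeter matrix over $[n]$, and let $W_M=F'/R'$ be the associated even Coxeter group, where $F'$ is the free group on $\{s_i\mid i\in[n]\}$ and $R'$ is the normal closure in $F'$ of $\{s_i^2\mid i\in[n]\}\cup\{(s_is_j)^{n(i,j)}(s_js_i)^{-n(i,j)}\mid(i,j)\in\mathcal{B}\}$. Then $H_2(W_M)\cong (R'\cap[F',F'])/[F',R']$ is an elementary abelian $2$-group with basis $$\{[s_i,s_j]^{n(i,j)}\bmod[F',R']\mid(i,j)\in\mathcal{B}\}.$$
   Context: Let $n\ge 1$ and $[n]=\{1,\dots,n\}$. A Coxeter matrix over $[n]$ is a symmetric $n\times n$ matrix $M=(m(i,j))$ with $m(i,i)=1$ and $m(i,j)=m(j,i)\in\{2,3,4,\dots\}\cup\{\infty\}$ for $i\ne j$. It is even if every $m(i,j)$ with $i\neq j$ is an even positive integer or $\infty$. For $M$ even and $i\neq j$, put $n(i,j)=m(i,j)/2$ if $m(i,j)<\infty$ and $n(i,j)=\infty$ otherwise, and set $\mathcal{B}=\{(i,j)\mid 1\le i<j\le n,\ n(i,j)<\infty\}$. The even Coxeter group $W_M$ is generated by $s_i$ ($i\in[n]$) with relations $s_i^2=1$ ($i\in[n]$) and $(s_is_j)^{n(i,j)}=(s_js_i)^{n(i,j)}$ for $(i,j)\in\mathcal{B}$; equivalently, $(s_is_j)^{m(i,j)}=1$ whenever $m(i,j)<\infty$. Commutators are $[g,h]=ghg^{-1}h^{-1}$, and $[F',R']$ is the subgroup generated by all $[f,r]$ with $f\in F'$, $r\in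 R'$. Homology is with coefficients in $\mathbb{Z}$, and $H_2(F'/R')\cong(R'\cap[F',F'])/[F',R']$ is Hopf's formula. A basis of an elementary abelian $2$-group means a basis as a vector space over $\mathbb{Z}/2$ (with the listed elements distinct for distinct $(i,j)\in\mathcal{B}$). *)

theory Defs
  imports "HOL-Algebra.Algebra" "HOL-Library.Extended_Nat" "HOL-Library.Z2"
begin

section \<open>Free groups\<close>

text \<open>The letter \<open>(x, True)\<close> stands for the generator \<open>x\<close> and \<open>(x, False)\<close> for its formal inverse.
  The free group on \<open>S\<close> is realised on the reduced words over \<open>S\<close>; the product of two reduced
  words is the reduced form of their concatenation.\<close>

definition letter_inv :: "'a \<times> bool \<Rightarrow> 'a \<times> bool" where
  "letter_inv l = (fst l, \<not> snd l)"

definition reduced_word :: "('a \<times> bool) list \<Rightarrow> bool" where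
  "reduced_word w \<longleftrightarrow> successively (\<lambda>k l. l \<noteq> letter_inv k) w"

definition push_letter :: "'a \<times> bool \<Rightarrow> ('a \<times> bool) list \<Rightarrow> ('a \<times> bool) list" where
  "push_letter l w = (if w \<noteq> [] \<and> hd w = letter_inv l then tl w else l # w)"

definition free_group :: "'a set \<Rightarrow> ('a \<times> bool) list monoid" where
  "free_group S = \<lparr>carrier = {w. reduced_word w \<and> fst ` set w \<subseteq> S},
                   monoid.mult = foldr push_letter,
                   one = []\<rparr>"

definition free_gen :: "'a \<Rightarrow> ('a \<times> bool) list" where
  "free_gen x = [(x, True)]"


section \<open>Normal closures and commutators\<close>

definition normal_closure :: "('a, 'b) monoid_scheme \<Rightarrow> 'a set \<Rightarrow> 'a set" where
  "normal_closure G S = \<Inter> {N. N \<lhd> G \<and> S \<subseteq> N}"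

definition group_commutator :: "('a, 'b) monoid_scheme \<Rightarrow> 'a \<Rightarrow> 'a \<Rightarrow> 'a" where
  "group_commutator G g h = g \<otimes>\<^bsub>G\<^esub> h \<otimes>\<^bsub>G\<^esub> inv\<^bsub>G\<^esub> g \<otimes>\<^bsub>G\<^esub> inv\<^bsub>G\<^esub> h"

definition commutator_subgroup :: "('a, 'b) monoid_scheme \<Rightarrow> 'a set \<Rightarrow> 'a set \<Rightarrow> 'a set" where
  "commutator_subgroup G H K = generate G {group_commutator G h k | h k. h \<in> H \<and> k \<in> K}"


section \<open>Integral group homology\<close>

text \<open>Homology of the inhomogeneous (unnormalised) bar complex with trivial integer coefficients:
  degree \<open>n\<close> is free abelian on the tuples \<open>[g\<^sub>1|\<dots>|g\<^sub>n]\<close>, and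
  \<open>d [g\<^sub>1|\<dots>|g\<^sub>n] = [g\<^sub>2|\<dots>|g\<^sub>n] + (\<Sum>i=1..n-1. (-1)^i [g\<^sub>1|\<dots>|g\<^sub>i g\<^sub>i\<^sub>+\<^sub>1|\<dots>|g\<^sub>n]) + (-1)^n [g\<^sub>1|\<dots>|g\<^sub>n\<^sub>-\<^sub>1]\<close>,
  with \<open>d = 0\<close> in degree 0. List positions below count from 0.\<close>

definition bar_chain_group :: "('a, 'b) monoid_scheme \<Rightarrow> nat \<Rightarrow> ('a list \<Rightarrow>\<^sub>0 int) monoid" where
  "bar_chain_group G n = free_Abelian_group {gs. length gs = n \<and> set gs \<subseteq> carrier G}"

definition bar_boundary_gen :: "('a, 'b) monoid_scheme \<Rightarrow> 'a list \<Rightarrow> 'a list \<Rightarrow>\<^sub>0 int" where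
  "bar_boundary_gen G gs =
     (if gs = [] then 0
      else frag_of (tl gs)
         + (\<Sum>i = 1..<length gs. frag_cmul ((-1) ^ i)
              (frag_of (take (i - 1) gs @ (gs ! (i - 1) \<otimes>\<^bsub>G\<^esub> gs ! i) # drop (i + 1) gs)))
         + frag_cmul ((-1) ^ length gs) (frag_of (butlast gs)))"

definition bar_boundary ::
    "('a, 'b) monoid_scheme \<Rightarrow> ('a list \<Rightarrow>\<^sub>0 int) \<Rightarrow> 'a list \<Rightarrow>\<^sub>0 int" where
  "bar_boundary G = frag_extend (bar_boundary_gen G)"

definition bar_cycles :: "('a, 'b) monoid_scheme \<Rightarrow> nat \<Rightarrow> ('a list \<Rightarrow>\<^sub>0 int) set" where
  "bar_cycles G n = {c \<in> carrier (bar_chain_group G n). bar_boundary G c = 0}"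

definition bar_boundaries :: "('a, 'b) monoid_scheme \<Rightarrow> nat \<Rightarrow> ('a list \<Rightarrow>\<^sub>0 int) set" where
  "bar_boundaries G n = bar_boundary G ` carrier (bar_chain_group G (Suc n))"

definition integral_homology ::
    "nat \<Rightarrow> ('a, 'b) monoid_scheme \<Rightarrow> ('a list \<Rightarrow>\<^sub>0 int) set monoid" where
  "integral_homology n G =
     (bar_chain_group G n)\<lparr>carrier := bar_cycles G n\<rparr> Mod bar_boundaries G n"

text \<open>For \<open>F\<close> free and \<open>R\<close> normal in \<open>F\<close>: the group \<open>(R \<inter> [F,F]) / [F,R]\<close> of Hopf's formula.\<close>

definition hopf_group :: "('a, 'b) monoid_scheme \<Rightarrow> 'a set \<Rightarrow> 'a set monoid" where
  "hopf_group F R =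
     F\<lparr>carrier := R \<inter> commutator_subgroup F (carrier F) (carrier F)\<rparr>
       Mod commutator_subgroup F (carrier F) R"


section \<open>Elementary abelian 2-groups\<close>

definition elementary_abelian_2_group :: "('a, 'b) monoid_scheme \<Rightarrow> bool" where
  "elementary_abelian_2_group G \<longleftrightarrow> comm_group G \<and> (\<forall>x \<in> carrier G. x \<otimes>\<^bsub>G\<^esub> x = \<one>\<^bsub>G\<^esub>)"

text \<open>Such a group is a vector space over the two-element field \<^typ>\<open>bit\<close>; the vector space
  operations are written multiplicatively.\<close>

definition bit_scale :: "('a, 'b) monoid_scheme \<Rightarrow> bit \<Rightarrow> 'a \<Rightarrow> 'a" where
  "bit_scale G a x = (if a = 1 then x else \<one>\<^bsub>G\<^esub>)"

definition bit_lincomb :: "('a, 'b) monoid_scheme \<Rightarrow> 'a set \<Rightarrow> ('a \<Rightarrow> bit) \<Rightarrow> 'a" where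
  "bit_lincomb G T c = finprod G (\<lambda>x. bit_scale G (c x) x) T"

definition bit_independent :: "('a, 'b) monoid_scheme \<Rightarrow> 'a set \<Rightarrow> bool" where
  "bit_independent G B \<longleftrightarrow>
     (\<forall>T c. finite T \<and> T \<subseteq> B \<longrightarrow> bit_lincomb G T c = \<one>\<^bsub>G\<^esub> \<longrightarrow> (\<forall>x \<in> T. c x = 0))"

definition bit_span :: "('a, 'b) monoid_scheme \<Rightarrow> 'a set \<Rightarrow> 'a set" where
  "bit_span G B = {bit_lincomb G T c | T c. finite T \<and> T \<subseteq> B}"

definition bit_basis :: "('a, 'b) monoid_scheme \<Rightarrow> 'a set \<Rightarrow> bool" where
  "bit_basis G B \<longleftrightarrow> B \<subseteq> carrier G \<and> bit_independent G B \<and> bit_span G B = carrier G"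


section \<open>Even Coxeter groups\<close>

text \<open>Matrices over \<open>{1..n}\<close> are functions of which only the entries with indices in \<open>{1..n}\<close> matter.\<close>

definition coxeter_matrix :: "nat \<Rightarrow> (nat \<Rightarrow> nat \<Rightarrow> enat) \<Rightarrow> bool" where
  "coxeter_matrix n m \<longleftrightarrow>
     (\<forall>i \<in> {1..n}. m i i = 1) \<and>
     (\<forall>i \<in> {1..n}. \<forall>j \<in> {1..n}. i \<noteq> j \<longrightarrow> m i j = m j i \<and> 2 \<le> m i j)"

definition even_coxeter_matrix :: "nat \<Rightarrow> (nat \<Rightarrow> nat \<Rightarrow> enat) \<Rightarrow> bool" where
  "even_coxeter_matrix n m \<longleftrightarrow>
     coxeter_matrix n m \<and>
     (\<forall>i \<in> {1..n}. \<forall>j \<in> {1..n}. i \<noteq> j \<longrightarrow>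
        m i j = \<infinity> \<or> (\<exists>k. m i j = enat k \<and> even k \<and> 0 < k))"

definition half_entry :: "(nat \<Rightarrow> nat \<Rightarrow> enat) \<Rightarrow> nat \<Rightarrow> nat \<Rightarrow> enat" where
  "half_entry m i j = (case m i j of enat k \<Rightarrow> enat (k div 2) | \<infinity> \<Rightarrow> \<infinity>)"

definition finite_pairs :: "nat \<Rightarrow> (nat \<Rightarrow> nat \<Rightarrow> enat) \<Rightarrow> (nat \<times> nat) set" where
  "finite_pairs n m = {(i, j). 1 \<le> i \<and> i < j \<and> j \<le> n \<and> half_entry m i j < \<infinity>}"

text \<open>The value of \<^const>\<open>half_entry\<close> as an exponent; meaningful on \<^const>\<open>finite_pairs\<close> only.\<close>

definition half_exp :: "(nat \<Rightarrow> nat \<Rightarrow> enat) \<Rightarrow> nat \<Rightarrow> nat \<Rightarrow> nat" where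
  "half_exp m i j = the_enat (half_entry m i j)"

definition coxeter_free :: "nat \<Rightarrow> (nat \<times> bool) list monoid" where
  "coxeter_free n = free_group {1..n}"

definition even_coxeter_relators ::
    "nat \<Rightarrow> (nat \<Rightarrow> nat \<Rightarrow> enat) \<Rightarrow> (nat \<times> bool) list set" where
  "even_coxeter_relators n m =
     (let F = coxeter_free n; s = free_gen in
       {s i [^]\<^bsub>F\<^esub> (2::nat) | i. i \<in> {1..n}} \<union>
       {((s i \<otimes>\<^bsub>F\<^esub> s j) [^]\<^bsub>F\<^esub> half_exp m i j) \<otimes>\<^bsub>F\<^esub> inv\<^bsub>F\<^esub> ((s j \<otimes>\<^bsub>F\<^esub> s i) [^]\<^bsub>F\<^esub> half_exp m i j)
          | i j. (i, j) \<in> finite_pairs n m})"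

definition even_coxeter_kernel ::
    "nat \<Rightarrow> (nat \<Rightarrow> nat \<Rightarrow> enat) \<Rightarrow> (nat \<times> bool) list set" where
  "even_coxeter_kernel n m = normal_closure (coxeter_free n) (even_coxeter_relators n m)"

definition even_coxeter_group ::
    "nat \<Rightarrow> (nat \<Rightarrow> nat \<Rightarrow> enat) \<Rightarrow> (nat \<times> bool) list set monoid" where
  "even_coxeter_group n m = coxeter_free n Mod even_coxeter_kernel n m"

definition commutator_power_class ::
    "nat \<Rightarrow> (nat \<Rightarrow> nat \<Rightarrow> enat) \<Rightarrow> nat \<times> nat \<Rightarrow> (nat \<times> bool) list set" where
  "commutator_power_class n m =
     (\<lambda>(i, j). let F = coxeter_free n in
        commutator_subgroup F (carrier F) (even_coxeter_kernel n m) #>\<^bsub>F\<^esub>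
          (group_commutator F (free_gen i) (free_gen j) [^]\<^bsub>F\<^esub> half_exp m i j))"

end

(* A set-theoretic section of F -> G = F/R turns bar 2-chains of G into elements of R/[F,R]; the cocycle
   identity makes this vanish on boundaries. Conversely, since F is free, the bar cocycle pulled back to F is
   a coboundary modulo boundaries, and a trivialisation assigns to each relator a 2-chain. On cycles and on
   the intersection of R with [F,F] these two constructions are mutually inverse, which is Hopf's formula.

   In F/[F,R] the squares of the generators s_i are central, so the relator of (i,j) becomes the central
   element [s_i,s_j]^n(i,j); conjugation by s_i inverts it, so its order divides 2. Hence R/[F,R] is generated
   by the squares and these classes, and in [F,F] the squares cancel because exponent sums vanish. For
   independence, retract F onto the two generators k, l and map them to reflections of the infinite dihedral
   group: R goes to rotations by multiples of 2 n(k,l) and [F,R] to multiples of 4 n(k,l), while only the class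
   of (k,l) is sent to an odd multiple of 2 n(k,l). *)

theory Submission
  imports Defs
begin

section \<open>Free groups\<close>

text \<open>Evenness enters twice. The relator of \<open>(i, j)\<close> has exponent sum 0 in every
  generator, so exponent sums see only the squares, and an integral vector v with v + v = 0
  vanishes. And this relator becomes trivial once one of its two generators is sent to 1, so a map
  to the dihedral group that keeps only \<open>k\<close> and \<open>l\<close> sees only the relator
  of \<open>(k, l)\<close>. The step from 2 n(k,l) to 4 n(k,l) is due to reflections inverting
  rotations: for a rotation r, the commutator [f, r] is trivial or the inverse square of r. In
  Hopf's formula the passage from chains to relators is an induction over all 2-chains, whereas only
  cycles give elements of [F,F]. The statement about a chain c therefore carries correction terms
  that depend on the boundary of c and disappear for cycles. The bar complex is not normalised and
  the section need not send 1 to 1; both produce terms [1|1] that have to match.\<close>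

lemma letter_inv_letter_inv [simp]: "letter_inv (letter_inv l) = l"
  by (simp add: letter_inv_def)

lemma fst_letter_inv [simp]: "fst (letter_inv l) = fst l"
  by (simp add: letter_inv_def)

lemma snd_letter_inv [simp]: "snd (letter_inv l) \<longleftrightarrow> \<not> snd l"
  by (simp add: letter_inv_def)

lemma reduced_word_Nil [simp]: "reduced_word []"
  by (simp add: reduced_word_def)

lemma reduced_word_Cons:
  "reduced_word (l # w) \<longleftrightarrow> (w = [] \<or> hd w \<noteq> letter_inv l) \<and> reduced_word w"
  by (cases w) (auto simp: reduced_word_def)

lemma reduced_word_push_letter:
  "reduced_word w \<Longrightarrow> reduced_word (push_letter l w)"
  by (cases w) (auto simp: push_letter_def reduced_word_Cons)

lemma letters_push_letter: "fst ` set (push_letter l w) \<subseteq> insert (fst l) (fst ` set w)"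
  by (cases w) (auto simp: push_letter_def)

lemma push_letter_cancel:
  assumes "reduced_word w"
  shows "push_letter (letter_inv l) (push_letter l w) = w"
  using assms by (cases w) (auto simp: push_letter_def reduced_word_Cons)

lemma push_letter_cancel':
  assumes "reduced_word w"
  shows "push_letter l (push_letter (letter_inv l) w) = w"
  using push_letter_cancel [OF assms, of "letter_inv l"] by simp

lemma reduced_word_foldr:
  "reduced_word w \<Longrightarrow> reduced_word (foldr push_letter u w)"
  by (induction u) (auto simp: reduced_word_push_letter)

lemma letters_foldr:
  "fst ` set (foldr push_letter u w) \<subseteq> fst ` set u \<union> fst ` set w"
proof (induction u)
  case (Cons l u)
  then show ?case
    using letters_push_letter [of l "foldr push_letter u w"] by simp blast
qed simp

text \<open>Associativity for a single letter. A letter and its inverse act on reduced words as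
  mutually inverse maps, so a cancellation inside the left factor does not change the
  result.\<close>

lemma foldr_push_letter:
  assumes "reduced_word w"
  shows "foldr push_letter (push_letter l v) w = push_letter l (foldr push_letter v w)"
proof (cases "v \<noteq> [] \<and> hd v = letter_inv l")
  case True
  then obtain v' where "v = letter_inv l # v'"
    by (metis list.collapse)
  then show ?thesis
    by (simp add: push_letter_def [of l "letter_inv l # v'"] push_letter_cancel' reduced_word_foldr assms)
qed (auto simp: push_letter_def)

lemma foldr_push_letter_assoc:
  assumes "reduced_word w"
  shows "foldr push_letter (foldr push_letter u v) w = foldr push_letter u (foldr push_letter v w)"
  by (induction u) (simp_all add: foldr_push_letter assms)

lemma carrier_free_group:
  "w \<in> carrier (free_group S) \<longleftrightarrow> reduced_word w \<and> fst ` set w \<subseteq> S"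
  by (simp add: free_group_def)

lemma mult_free_group: "u \<otimes>\<^bsub>free_group S\<^esub> v = foldr push_letter u v"
  by (simp add: free_group_def)

lemma one_free_group [simp]: "\<one>\<^bsub>free_group S\<^esub> = []"
  by (simp add: free_group_def)

lemma free_group_left_inverse:
  assumes "reduced_word w" "fst ` set w \<subseteq> S"
  shows "\<exists>v. reduced_word v \<and> fst ` set v \<subseteq> S \<and> foldr push_letter v w = []"
  using assms
proof (induction w)
  case (Cons l w)
  then obtain v where v: "reduced_word v" "fst ` set v \<subseteq> S" "foldr push_letter v w = []"
    by (auto simp: reduced_word_Cons)
  \<comment> \<open>The inverse of \<open>l # w\<close> is the inverse \<open>v\<close> of
    \<open>w\<close> followed by the inverse letter, multiplied out so that it is reduced.\<close>
  define u where "u = foldr push_letter v [letter_inv l]"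
  have l: "reduced_word [letter_inv l]" "reduced_word (l # w)"
    using Cons.prems by (auto simp: reduced_word_Cons)
  have "foldr push_letter u (l # w) = foldr push_letter v (push_letter (letter_inv l) (l # w))"
    unfolding u_def using foldr_push_letter_assoc [OF l(2), of v "[letter_inv l]"] by simp
  also have "\<dots> = []"
    using v by (simp add: push_letter_def)
  finally have "foldr push_letter u (l # w) = []" .
  moreover have "reduced_word u"
    unfolding u_def using l by (intro reduced_word_foldr)
  moreover have "fst ` set u \<subseteq> S"
    unfolding u_def using v(2) Cons.prems(2)
    by (intro order_trans [OF letters_foldr]) simp
  ultimately show ?case
    by blast
qed (auto intro: exI [of _ "[]"])

lemma group_free_group: "group (free_group S)"
proof (rule groupI)
  fix x y assume "x \<in> carrier (free_group S)" "y \<in> carrier (free_group S)"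
  then show "x \<otimes>\<^bsub>free_group S\<^esub> y \<in> carrier (free_group S)"
    using letters_foldr [of x y] by (simp add: carrier_free_group mult_free_group reduced_word_foldr) blast
next
  fix x assume "x \<in> carrier (free_group S)"
  then show "\<exists>y\<in>carrier (free_group S). y \<otimes>\<^bsub>free_group S\<^esub> x = \<one>\<^bsub>free_group S\<^esub>"
    using free_group_left_inverse [of x S] by (auto simp: carrier_free_group mult_free_group)
qed (auto simp: carrier_free_group mult_free_group foldr_push_letter_assoc)

lemma free_gen_carrier: "x \<in> S \<Longrightarrow> free_gen x \<in> carrier (free_group S)"
  by (simp add: carrier_free_group free_gen_def reduced_word_Cons)

lemma letter_carrier: "fst l \<in> S \<Longrightarrow> [l] \<in> carrier (free_group S)"
  by (simp add: carrier_free_group reduced_word_Cons)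

lemma free_group_Cons:
  assumes "l # w \<in> carrier (free_group S)"
  shows "l # w = [l] \<otimes>\<^bsub>free_group S\<^esub> w" "[l] \<in> carrier (free_group S)" "w \<in> carrier (free_group S)"
  using assms by (auto simp: carrier_free_group mult_free_group reduced_word_Cons push_letter_def)

section \<open>Universal property of the free group\<close>

definition letter_lift :: "('b, 'c) monoid_scheme \<Rightarrow> ('a \<Rightarrow> 'b) \<Rightarrow> 'a \<times> bool \<Rightarrow> 'b" where
  "letter_lift G f l = (if snd l then f (fst l) else inv\<^bsub>G\<^esub> f (fst l))"

text \<open>A right fold, parallel to \<open>foldr push_letter\<close>: multiplicativity then
  reduces to pushing one letter.\<close>

definition free_lift :: "('b, 'c) monoid_scheme \<Rightarrow> ('a \<Rightarrow> 'b) \<Rightarrow> ('a \<times> bool) list \<Rightarrow> 'b" where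
  "free_lift G f w = foldr (\<lambda>l. monoid.mult G (letter_lift G f l)) w \<one>\<^bsub>G\<^esub>"

context group
begin

lemma letter_lift_closed: "f \<in> S \<rightarrow> carrier G \<Longrightarrow> fst l \<in> S \<Longrightarrow> letter_lift G f l \<in> carrier G"
  by (auto simp: letter_lift_def)

lemma free_lift_closed:
  assumes "f \<in> S \<rightarrow> carrier G" "fst ` set w \<subseteq> S"
  shows "free_lift G f w \<in> carrier G"
  using assms(2) by (induction w) (auto simp: free_lift_def letter_lift_closed [OF assms(1)])

lemma free_lift_push_letter:
  assumes f: "f \<in> S \<rightarrow> carrier G" and w: "fst ` set w \<subseteq> S" and l: "fst l \<in> S"
  shows "free_lift G f (push_letter l w) = letter_lift G f l \<otimes> free_lift G f w"
proof (cases "w \<noteq> [] \<and> hd w = letter_inv l")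
  case True
  then obtain v where v: "w = letter_inv l # v"
    by (metis list.collapse)
  then have "fst ` set v \<subseteq> S"
    using w by auto
  then have "free_lift G f v \<in> carrier G"
    by (rule free_lift_closed [OF f])
  moreover have "letter_lift G f (letter_inv l) \<in> carrier G" "letter_lift G f l \<in> carrier G"
    by (auto intro!: letter_lift_closed [OF f] simp: l)
  moreover have "letter_lift G f l \<otimes> letter_lift G f (letter_inv l) = \<one>"
    using funcset_mem [OF f l] by (simp add: letter_lift_def letter_inv_def)
  moreover have "free_lift G f w = letter_lift G f (letter_inv l) \<otimes> free_lift G f v"
    by (simp add: v free_lift_def)
  moreover have "push_letter l w = v"
    by (simp add: v push_letter_def)
  ultimately show ?thesis
    by (simp flip: m_assoc)
next
  case False
  then have "push_letter l w = l # w"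
    by (auto simp: push_letter_def)
  then show ?thesis
    by (simp add: free_lift_def)
qed

lemma free_lift_hom:
  assumes f: "f \<in> S \<rightarrow> carrier G"
  shows "free_lift G f \<in> hom (free_group S) G"
proof (rule homI)
  fix u v assume "u \<in> carrier (free_group S)" "v \<in> carrier (free_group S)"
  then have "fst ` set u \<subseteq> S" and v: "fst ` set v \<subseteq> S"
    by (auto simp: carrier_free_group)
  then have "free_lift G f (foldr push_letter u v) = free_lift G f u \<otimes> free_lift G f v"
  proof (induction u)
    case Nil
    then show ?case
      using free_lift_closed [OF f] by (simp add: free_lift_def)
  next
    case (Cons l u)
    have uv: "fst ` set (foldr push_letter u v) \<subseteq> S"
      using letters_foldr [of u v] Cons.prems by simp blast
    have "free_lift G f (foldr push_letter (l # u) v)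
        = letter_lift G f l \<otimes> (free_lift G f u \<otimes> free_lift G f v)"
      using Cons free_lift_push_letter [OF f uv] by simp
    moreover have "free_lift G f (l # u) = letter_lift G f l \<otimes> free_lift G f u"
      by (simp add: free_lift_def)
    moreover have "letter_lift G f l \<in> carrier G" "free_lift G f u \<in> carrier G" "free_lift G f v \<in> carrier G"
      using Cons.prems by (auto intro!: free_lift_closed [OF f] letter_lift_closed [OF f])
    ultimately show ?case
      by (simp add: m_assoc)
  qed
  then show "free_lift G f (u \<otimes>\<^bsub>free_group S\<^esub> v) = free_lift G f u \<otimes> free_lift G f v"
    by (simp add: mult_free_group)
qed (auto intro: free_lift_closed [OF f] simp: carrier_free_group)

lemma free_lift_free_gen: "f x \<in> carrier G \<Longrightarrow> free_lift G f (free_gen x) = f x"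
  by (simp add: free_lift_def free_gen_def letter_lift_def)

end


section \<open>Normal closures and commutators\<close>

context group
begin

lemma group_commutator_closed:
  "x \<in> carrier G \<Longrightarrow> y \<in> carrier G \<Longrightarrow> group_commutator G x y \<in> carrier G"
  by (simp add: group_commutator_def)

lemma normal_closure_normal:
  assumes "S \<subseteq> carrier G"
  shows "normal_closure G S \<lhd> G" "S \<subseteq> normal_closure G S"
proof -
  let ?A = "{N. N \<lhd> G \<and> S \<subseteq> N}"
  \<comment> \<open>The family must be nonempty, or its intersection would be the whole type instead
    of a subgroup.\<close>
  have ne: "carrier G \<in> ?A"
    using assms normal_self by blast
  have sub: "subgroup N G" if "N \<in> ?A" for N
    using that normal_imp_subgroup by blast
  have "subgroup (normal_closure G S) G"
    unfolding normal_closure_def by (rule subgroups_Inter) (use sub ne in auto)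
  moreover have "g \<otimes> h \<otimes> inv g \<in> normal_closure G S"
    if "g \<in> carrier G" "h \<in> normal_closure G S" for g h
    using that normal.inv_op_closed2 unfolding normal_closure_def by fastforce
  ultimately show "normal_closure G S \<lhd> G"
    by (simp add: normal_inv_iff)
  show "S \<subseteq> normal_closure G S"
    by (auto simp: normal_closure_def)
qed

lemma normal_closure_minimal: "N \<lhd> G \<Longrightarrow> S \<subseteq> N \<Longrightarrow> normal_closure G S \<subseteq> N"
  by (auto simp: normal_closure_def)

lemma commutator_subgroup_minimal:
  assumes "subgroup N G" "\<And>h k. h \<in> H \<Longrightarrow> k \<in> K \<Longrightarrow> group_commutator G h k \<in> N"
  shows "commutator_subgroup G H K \<subseteq> N"
  unfolding commutator_subgroup_def
  by (rule generate_subgroup_incl [OF _ assms(1)]) (use assms(2) in auto)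

lemma group_commutator_in_subgroup:
  "h \<in> H \<Longrightarrow> k \<in> K \<Longrightarrow> group_commutator G h k \<in> commutator_subgroup G H K"
  unfolding commutator_subgroup_def by (rule generate.incl) auto

lemma group_commutator_conj:
  assumes "x \<in> carrier G" "y \<in> carrier G" "g \<in> carrier G"
  shows "g \<otimes> group_commutator G x y \<otimes> inv g
       = group_commutator G (g \<otimes> x \<otimes> inv g) (g \<otimes> y \<otimes> inv g)"
proof -
  have c: "inv g \<otimes> (g \<otimes> z) = z" if "z \<in> carrier G" for z
    using assms that by (simp flip: m_assoc)
  show ?thesis
    using assms by (simp add: group_commutator_def inv_mult_group m_assoc c)
qed

text \<open>The generating set is closed under conjugation, because a conjugate of a commutator is
  the commutator of the conjugates. Applied to both [F,R] and [F,F].\<close>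

lemma normal_commutator_subgroup:
  assumes H: "H \<lhd> G" and K: "K \<lhd> G"
  shows "commutator_subgroup G H K \<lhd> G"
  unfolding commutator_subgroup_def
proof (rule normal_generateI)
  have HK: "H \<subseteq> carrier G" "K \<subseteq> carrier G"
    using H K by (auto dest: normal_imp_subgroup subgroup.mem_carrier)
  then show "{group_commutator G h k |h k. h \<in> H \<and> k \<in> K} \<subseteq> carrier G"
    by (auto intro!: group_commutator_closed)
  fix h g assume "h \<in> {group_commutator G h k |h k. h \<in> H \<and> k \<in> K}" and g: "g \<in> carrier G"
  then obtain x y where xy: "x \<in> H" "y \<in> K" "h = group_commutator G x y"
    by auto
  then have "g \<otimes> h \<otimes> inv g = group_commutator G (g \<otimes> x \<otimes> inv g) (g \<otimes> y \<otimes> inv g)"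
    using HK g group_commutator_conj by blast
  moreover have "g \<otimes> x \<otimes> inv g \<in> H" "g \<otimes> y \<otimes> inv g \<in> K"
    using xy g normal.inv_op_closed2 H K by metis+
  ultimately show "g \<otimes> h \<otimes> inv g \<in> {group_commutator G h k |h k. h \<in> H \<and> k \<in> K}"
    by blast
qed

lemma commutator_subgroup_subset_right:
  assumes K: "K \<lhd> G" and H: "H \<subseteq> carrier G"
  shows "commutator_subgroup G H K \<subseteq> K"
proof (rule commutator_subgroup_minimal [OF normal_imp_subgroup [OF K]])
  interpret K: normal K G by (rule K)
  fix h k assume "h \<in> H" "k \<in> K"
  then have "h \<in> carrier G" "k \<in> K" "h \<otimes> k \<otimes> inv h \<in> K"
    using H K.inv_op_closed2 by auto
  then show "group_commutator G h k \<in> K"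
    by (simp add: group_commutator_def)
qed

lemma commutator_subgroup_carrier: "commutator_subgroup G (carrier G) (carrier G) = derived G (carrier G)"
proof -
  have "{group_commutator G h k |h k. h \<in> carrier G \<and> k \<in> carrier G} = derived_set G (carrier G)"
    by (auto simp: group_commutator_def)
  then show ?thesis
    by (simp add: commutator_subgroup_def derived_def)
qed

lemma group_commutator_eq_one_iff:
  assumes "x \<in> carrier G" "y \<in> carrier G"
  shows "group_commutator G x y = \<one> \<longleftrightarrow> x \<otimes> y = y \<otimes> x"
proof -
  have "group_commutator G x y = (x \<otimes> y) \<otimes> inv (y \<otimes> x)"
    using assms by (simp add: group_commutator_def inv_mult_group m_assoc)
  then show ?thesis
    using assms by (metis inv_closed inv_equality inv_inv m_closed r_inv)
qed

end

lemma (in group_hom) hom_group_commutator: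
  assumes "x \<in> carrier G" "y \<in> carrier G"
  shows "h (group_commutator G x y) = group_commutator H (h x) (h y)"
  using assms by (simp add: group_commutator_def)

lemma (in group_hom) commute_if_commutator_kernel:
  assumes "group_commutator G x y \<in> kernel G H h" "x \<in> carrier G" "y \<in> carrier G"
  shows "h y \<otimes>\<^bsub>H\<^esub> h x = h x \<otimes>\<^bsub>H\<^esub> h y"
  using assms H.group_commutator_eq_one_iff [of "h x" "h y"] by (simp add: kernel_def hom_group_commutator)

lemma (in group_hom) commutator_subgroup_kernel:
  assumes "\<And>x y. x \<in> A \<Longrightarrow> y \<in> B \<Longrightarrow> h x \<otimes>\<^bsub>H\<^esub> h y = h y \<otimes>\<^bsub>H\<^esub> h x"
    and "A \<subseteq> carrier G" "B \<subseteq> carrier G"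
  shows "commutator_subgroup G A B \<subseteq> kernel G H h"
proof (rule G.commutator_subgroup_minimal [OF subgroup_kernel])
  fix x y assume "x \<in> A" "y \<in> B"
  then have "x \<in> carrier G" "y \<in> carrier G" "h x \<otimes>\<^bsub>H\<^esub> h y = h y \<otimes>\<^bsub>H\<^esub> h x"
    using assms by auto
  then show "group_commutator G x y \<in> kernel G H h"
    by (simp add: kernel_def G.group_commutator_closed hom_group_commutator H.group_commutator_eq_one_iff)
qed

text \<open>The way in which membership in [F,F] is exploited: \<open>defect\<close>, the corrected
  boundary of \<open>chain\<close>, and \<open>expo\<close> are homomorphisms into commutative
  groups, hence vanish there.\<close>

lemma (in group) hom_commutator_trivial:
  assumes "h \<in> hom G H" "comm_group H" "x \<in> commutator_subgroup G (carrier G) (carrier G)"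
  shows "h x = \<one>\<^bsub>H\<^esub>"
proof -
  interpret H: comm_group H by fact
  interpret h: group_hom G H h
    by unfold_locales fact
  have "commutator_subgroup G (carrier G) (carrier G) \<subseteq> kernel G H h"
    by (rule h.commutator_subgroup_kernel) (auto intro: H.m_comm)
  then show ?thesis
    using assms by (auto simp: kernel_def)
qed

text \<open>Sections \<open>A/N\<close> of \<open>G\<close> are viewed inside the quotient \<open>G/N\<close>.\<close>

lemma FactGroup_carrier_update:
  "A \<subseteq> carrier G \<Longrightarrow> (G\<lparr>carrier := A\<rparr>) Mod N = (G Mod N)\<lparr>carrier := (\<lambda>a. N #>\<^bsub>G\<^esub> a) ` A\<rparr>"
  by (auto simp: FactGroup_def RCOSETS_def r_coset_def set_mult_def fun_eq_iff)

context normal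
begin

lemma group_hom_r_coset: "group_hom G (G Mod H) (\<lambda>a. H #> a)"
  by (simp add: group_hom_def group_hom_axioms_def factorgroup_is_group r_coset_hom_Mod is_group)

lemma r_coset_eq_one_iff: "a \<in> carrier G \<Longrightarrow> H #> a = H \<longleftrightarrow> a \<in> H"
  by (metis coset_join1 coset_join2 subgroup_axioms subset)

lemma r_coset_eq_iff:
  assumes "a \<in> carrier G" "b \<in> carrier G"
  shows "H #> a = H #> b \<longleftrightarrow> a \<otimes> inv b \<in> H"
proof -
  interpret p: group_hom G "G Mod H" "\<lambda>a. H #> a"
    by (rule group_hom_r_coset)
  have "H #> (a \<otimes> inv b) = (H #> a) \<otimes>\<^bsub>G Mod H\<^esub> inv\<^bsub>G Mod H\<^esub> (H #> b)"
    using assms p.hom_mult p.hom_inv by (metis inv_closed)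
  then have "a \<otimes> inv b \<in> H \<longleftrightarrow> (H #> a) \<otimes>\<^bsub>G Mod H\<^esub> inv\<^bsub>G Mod H\<^esub> (H #> b) = \<one>\<^bsub>G Mod H\<^esub>"
    using r_coset_eq_one_iff [of "a \<otimes> inv b"] assms by simp
  also have "\<dots> \<longleftrightarrow> H #> a = H #> b"
    using assms p.hom_closed by (metis p.H.inv_equality p.H.inv_inv p.H.inv_closed p.H.r_inv)
  finally show ?thesis ..
qed

end

section \<open>The bar complex in low degrees\<close>

lemma bar_boundary_gen_2:
  "bar_boundary_gen G [g, h] = frag_of [h] - frag_of [g \<otimes>\<^bsub>G\<^esub> h] + frag_of [g]"
proof -
  have "{1..<2::nat} = {1}"
    by auto
  then show ?thesis
    by (simp add: bar_boundary_gen_def)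
qed

lemma bar_boundary_gen_3:
  "bar_boundary_gen G [g, h, k] =
     frag_of [h, k] - frag_of [g \<otimes>\<^bsub>G\<^esub> h, k] + frag_of [g, h \<otimes>\<^bsub>G\<^esub> k] - frag_of [g, h]"
proof -
  have "{1..<3::nat} = {1, 2}"
    by auto
  then show ?thesis
    by (simp add: bar_boundary_gen_def)
qed

lemma bar_boundary_0 [simp]: "bar_boundary G 0 = 0"
  by (simp add: bar_boundary_def)

lemma bar_boundary_add: "bar_boundary G (a + b) = bar_boundary G a + bar_boundary G b"
  by (simp add: bar_boundary_def frag_extend_add)

lemma bar_boundary_minus: "bar_boundary G (- a) = - bar_boundary G a"
  by (simp add: bar_boundary_def frag_extend_minus)

lemma bar_boundary_diff: "bar_boundary G (a - b) = bar_boundary G a - bar_boundary G b"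
  by (simp add: bar_boundary_def frag_extend_diff)

abbreviation bar_chains :: "('a, 'b) monoid_scheme \<Rightarrow> nat \<Rightarrow> ('a list \<Rightarrow>\<^sub>0 int) set" where
  "bar_chains G n \<equiv> carrier (bar_chain_group G n)"

lemma one_bar_chain_group [simp]: "\<one>\<^bsub>bar_chain_group G n\<^esub> = 0"
  by (simp add: bar_chain_group_def)

lemma mult_bar_chain_group [simp]: "a \<otimes>\<^bsub>bar_chain_group G n\<^esub> b = a + b"
  by (simp add: bar_chain_group_def)

lemma group_bar_chain_group: "group (bar_chain_group G n)"
  by (simp add: bar_chain_group_def)

lemma comm_group_bar_chain_group: "comm_group (bar_chain_group G n)"
  by (simp add: bar_chain_group_def abelian_free_Abelian_group)

lemma bar_chains_0: "0 \<in> bar_chains G n"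
  by (simp add: bar_chain_group_def)

lemma bar_chains_add: "a \<in> bar_chains G n \<Longrightarrow> b \<in> bar_chains G n \<Longrightarrow> a + b \<in> bar_chains G n"
  by (simp add: bar_chain_group_def order_trans [OF keys_add])

lemma bar_chains_minus: "a \<in> bar_chains G n \<Longrightarrow> - a \<in> bar_chains G n"
  by (auto simp: bar_chain_group_def)

lemma bar_chains_diff: "a \<in> bar_chains G n \<Longrightarrow> b \<in> bar_chains G n \<Longrightarrow> a - b \<in> bar_chains G n"
  using bar_chains_add [of a G n "- b"] bar_chains_minus [of b G n] by simp

lemma bar_chains_of: "frag_of gs \<in> bar_chains G n \<longleftrightarrow> length gs = n \<and> set gs \<subseteq> carrier G"
  by (simp add: bar_chain_group_def)

lemmas bar_chains_intros = bar_chains_0 bar_chains_add bar_chains_minus bar_chains_diff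

lemma inv_bar_chain_group: "a \<in> bar_chains G n \<Longrightarrow> inv\<^bsub>bar_chain_group G n\<^esub> a = - a"
  by (simp add: bar_chain_group_def)

lemma bar_chains_induct [consumes 1, case_names zero diff of]:
  assumes "c \<in> bar_chains G n" "P 0"
    and "\<And>a b. a \<in> bar_chains G n \<Longrightarrow> b \<in> bar_chains G n \<Longrightarrow> P a \<Longrightarrow> P b \<Longrightarrow> P (a - b)"
    and "\<And>gs. length gs = n \<Longrightarrow> set gs \<subseteq> carrier G \<Longrightarrow> P (frag_of gs)"
  shows "P c"
  by (rule free_Abelian_group_induct [of c "{gs. length gs = n \<and> set gs \<subseteq> carrier G}"])
     (use assms in \<open>auto simp: bar_chain_group_def\<close>)

lemma bar_boundaries_0: "0 \<in> bar_boundaries G n"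
  unfolding bar_boundaries_def by (rule image_eqI [of _ _ 0]) (auto simp: bar_chains_0)

lemma bar_boundaries_add:
  "a \<in> bar_boundaries G n \<Longrightarrow> b \<in> bar_boundaries G n \<Longrightarrow> a + b \<in> bar_boundaries G n"
  unfolding bar_boundaries_def using bar_chains_add bar_boundary_add by (smt (verit) imageE imageI)

lemma bar_boundaries_minus: "a \<in> bar_boundaries G n \<Longrightarrow> - a \<in> bar_boundaries G n"
  unfolding bar_boundaries_def using bar_chains_minus bar_boundary_minus by (smt (verit) imageE imageI)

lemma bar_boundaries_diff:
  "a \<in> bar_boundaries G n \<Longrightarrow> b \<in> bar_boundaries G n \<Longrightarrow> a - b \<in> bar_boundaries G n"
  using bar_boundaries_add [of a G n "- b"] bar_boundaries_minus [of b G n] by simp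

text \<open>A relation on all 2-chains and not only on cycles: chains such as
  \<open>word_chain w\<close> have a nonzero boundary in general.\<close>

definition homologous :: "('a, 'b) monoid_scheme \<Rightarrow> ('a list \<Rightarrow>\<^sub>0 int) \<Rightarrow> ('a list \<Rightarrow>\<^sub>0 int) \<Rightarrow> bool" where
  "homologous G a b \<longleftrightarrow> a - b \<in> bar_boundaries G 2"

lemma homologousI: "x \<in> bar_boundaries G 2 \<Longrightarrow> a - b = x \<Longrightarrow> homologous G a b"
  by (simp add: homologous_def)

lemma homologous_refl [simp]: "homologous G a a"
  by (simp add: homologous_def bar_boundaries_0)

lemma homologous_sym: "homologous G a b \<Longrightarrow> homologous G b a"
  unfolding homologous_def using bar_boundaries_minus by fastforce

lemma homologous_trans [trans]: "homologous G a b \<Longrightarrow> homologous G b c \<Longrightarrow> homologous G a c"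
  unfolding homologous_def using bar_boundaries_add by fastforce

lemma homologous_add:
  assumes "homologous G a b" "homologous G c d"
  shows "homologous G (a + c) (b + d)"
  using bar_boundaries_add [OF assms [unfolded homologous_def]] by (simp add: homologous_def algebra_simps)

lemma homologous_diff:
  assumes "homologous G a b" "homologous G c d"
  shows "homologous G (a - c) (b - d)"
  using bar_boundaries_diff [OF assms [unfolded homologous_def]] by (simp add: homologous_def algebra_simps)

lemma homologous_minus: "homologous G a b \<Longrightarrow> homologous G (- a) (- b)"
  using homologous_diff [of G 0 0 a b] by simp

section \<open>The universal 2-cocycle and its degenerate values\<close>

context group
begin

lemma bar_cocycle:
  assumes "g \<in> carrier G" "h \<in> carrier G" "k \<in> carrier G"
  shows "homologous G (frag_of [h, k] + frag_of [g, h \<otimes> k]) (frag_of [g \<otimes> h, k] + frag_of [g, h])"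
proof -
  have "bar_boundary G (frag_of [g, h, k]) \<in> bar_boundaries G 2"
    using assms by (auto simp: bar_boundaries_def bar_chains_of)
  then show ?thesis
    by (rule homologousI) (simp add: bar_boundary_def bar_boundary_gen_3)
qed

text \<open>Degenerate chains do not vanish in the unnormalised complex, but the boundary of [1|1|g]
  identifies [1|g] with [1|1]; for [g|1] below it is the boundary of [g|1|1].\<close>

lemma bar_one_left:
  assumes "g \<in> carrier G"
  shows "homologous G (frag_of [\<one>, g]) (frag_of [\<one>, \<one>])"
proof -
  have "homologous G (frag_of [\<one>, g] + frag_of [\<one>, g] - frag_of [\<one>, g])
                     (frag_of [\<one>, g] + frag_of [\<one>, \<one>] - frag_of [\<one>, g])"
    using bar_cocycle [of \<one> \<one> g] assms by (intro homologous_diff) auto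
  then show ?thesis
    by simp
qed

lemma bar_one_right:
  assumes "g \<in> carrier G"
  shows "homologous G (frag_of [g, \<one>]) (frag_of [\<one>, \<one>])"
proof -
  have "homologous G (frag_of [\<one>, \<one>] + frag_of [g, \<one>] - frag_of [g, \<one>])
                     (frag_of [g, \<one>] + frag_of [g, \<one>] - frag_of [g, \<one>])"
    using bar_cocycle [of g \<one> \<one>] assms by (intro homologous_diff) auto
  then show ?thesis
    by (simp add: homologous_sym)
qed

lemma bar_boundary_bar_boundary:
  assumes "c \<in> bar_chains G 3"
  shows "bar_boundary G (bar_boundary G c) = 0"
  using assms
proof (induction rule: bar_chains_induct)
  case (of gs)
  then obtain g h k where "gs = [g, h, k]" "g \<in> carrier G" "h \<in> carrier G" "k \<in> carrier G"
    by (auto simp: length_Suc_conv numeral_3_eq_3)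
  then show ?case
    by (simp add: bar_boundary_def bar_boundary_gen_3 bar_boundary_gen_2 frag_extend_add
        frag_extend_diff m_assoc)
qed (simp_all add: bar_boundary_diff)

lemma bar_boundary_2_carrier:
  assumes "c \<in> bar_chains G 2"
  shows "bar_boundary G c \<in> bar_chains G 1"
  using assms
proof (induction rule: bar_chains_induct)
  case (of gs)
  then obtain g h where "gs = [g, h]" "g \<in> carrier G" "h \<in> carrier G"
    by (auto simp: length_Suc_conv numeral_2_eq_2)
  then show ?case
    by (auto simp: bar_boundary_def bar_boundary_gen_2 bar_chains_of intro!: bar_chains_intros)
qed (auto simp: bar_boundary_diff intro: bar_chains_intros)

lemma bar_boundary_3_carrier:
  assumes "c \<in> bar_chains G 3"
  shows "bar_boundary G c \<in> bar_chains G 2"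
  using assms
proof (induction rule: bar_chains_induct)
  case (of gs)
  then obtain g h k where "gs = [g, h, k]" "g \<in> carrier G" "h \<in> carrier G" "k \<in> carrier G"
    by (auto simp: length_Suc_conv numeral_3_eq_3)
  then show ?case
    by (auto simp: bar_boundary_def bar_boundary_gen_3 bar_chains_of intro!: bar_chains_intros)
qed (auto simp: bar_boundary_diff intro: bar_chains_intros)

lemma bar_boundaries_2_subset: "bar_boundaries G 2 \<subseteq> bar_cycles G 2"
  by (auto simp: bar_boundaries_def bar_cycles_def bar_boundary_bar_boundary bar_boundary_3_carrier)

lemma homologous_bar_boundary: "homologous G a b \<Longrightarrow> bar_boundary G a = bar_boundary G b"
  using bar_boundaries_2_subset bar_boundary_diff [of G a b]
  by (auto simp: homologous_def bar_cycles_def)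

lemma subgroup_bar_cycles: "subgroup (bar_cycles G n) (bar_chain_group G n)"
proof (rule group.subgroupI [OF group_bar_chain_group])
  have "0 \<in> bar_cycles G n"
    by (simp add: bar_cycles_def bar_chains_0)
  then show "bar_cycles G n \<noteq> {}"
    by blast
qed (auto simp: bar_cycles_def bar_chains_add bar_boundary_add inv_bar_chain_group bar_chains_minus
       bar_boundary_minus)

end


section \<open>The bar cocycle on a free group\<close>

locale free_group_hom = group_hom "free_group S" G p for S :: "'a set" and G (structure) and p
begin

text \<open>\<open>word_chain\<close> trivialises, modulo boundaries, the cocycle \<open>(u, v) \<mapsto> [p u|p v]\<close>. The constant
  \<open>- [1|1]\<close> is forced by the lack of normalisation: \<open>[1|g]\<close> is homologous to \<open>[1|1]\<close>, not to \<open>0\<close>.\<close>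

definition letter_chain :: "'a \<times> bool \<Rightarrow> 'b list \<Rightarrow>\<^sub>0 int" where
  "letter_chain l = (if snd l then 0 else - frag_of [\<one>, \<one>] - frag_of [p [letter_inv l], p [l]])"

primrec word_chain :: "('a \<times> bool) list \<Rightarrow> 'b list \<Rightarrow>\<^sub>0 int" where
  "word_chain [] = - frag_of [\<one>, \<one>]"
| "word_chain (l # w) = letter_chain l + word_chain w + frag_of [p [l], p w]"

lemma p_carrier [simp]: "fst l \<in> S \<Longrightarrow> p [l] \<in> carrier G"
  by (simp add: letter_carrier)

lemma p_Nil [simp]: "p [] = \<one>"
  using hom_one by simp

lemma p_push_letter:
  "w \<in> carrier (free_group S) \<Longrightarrow> fst l \<in> S \<Longrightarrow> p (push_letter l w) = p [l] \<otimes> p w"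
  using hom_mult [of "[l]" w] by (simp add: letter_carrier mult_free_group)

lemma p_letter_inv:
  assumes "fst l \<in> S"
  shows "p [l] \<otimes> p [letter_inv l] = \<one>"
  using p_push_letter [of "[letter_inv l]" l] assms by (simp add: push_letter_def letter_carrier)

lemma word_chain_carrier:
  "w \<in> carrier (free_group S) \<Longrightarrow> word_chain w \<in> bar_chains G 2"
proof (induction w)
  case (Cons l w)
  have lw: "w \<in> carrier (free_group S)" "fst l \<in> S"
    using Cons.prems by (auto simp: carrier_free_group reduced_word_Cons)
  then show ?case
    using Cons.IH by (auto simp: letter_chain_def bar_chains_of intro!: bar_chains_intros)
qed (auto simp: bar_chains_of intro!: bar_chains_intros)

text \<open>\<open>letter_chain\<close> is 0 on generators, and its value on inverse letters is
  solved from this relation, which is then an equality when \<open>l\<close> is a generator. For an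
  inverse letter the two orders [x|y] and [y|x] with xy = yx = 1 have to be compared, by the cocycle
  identity for (x, y, x).\<close>

lemma letter_chain_inverse:
  assumes l: "fst l \<in> S"
  shows "homologous G (letter_chain l + letter_chain (letter_inv l) + frag_of [p [l], p [letter_inv l]])
           (- frag_of [\<one>, \<one>])"
proof (cases "snd l")
  case True
  then show ?thesis
    by (simp add: letter_chain_def)
next
  case False
  let ?x = "p [letter_inv l]" and ?y = "p [l]"
  have xy: "?x \<in> carrier G" "?y \<in> carrier G" "?x \<otimes> ?y = \<one>" "?y \<otimes> ?x = \<one>"
    using l p_letter_inv [of l] p_letter_inv [of "letter_inv l"] by auto
  have "homologous G (frag_of [?y, ?x] + frag_of [?x, \<one>]) (frag_of [\<one>, ?x] + frag_of [?x, ?y])"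
    using H.bar_cocycle [of ?x ?y ?x] xy by simp
  from homologous_diff [OF this homologous_add [OF H.bar_one_right [OF xy(1)]
        homologous_refl [of G "frag_of [?x, ?y]"]]]
  have "homologous G (frag_of [?y, ?x] - frag_of [?x, ?y]) (frag_of [\<one>, ?x] - frag_of [\<one>, \<one>])"
    by (simp add: algebra_simps)
  from homologous_diff [OF homologous_trans [OF this homologous_diff [OF H.bar_one_left [OF xy(1)] homologous_refl]]
      homologous_refl [of G "frag_of [\<one>, \<one>]"]]
  show ?thesis
    using False by (simp add: letter_chain_def algebra_simps)
qed

text \<open>Without cancellation this is the recursion of \<open>word_chain\<close>. With
  cancellation it says that a letter and its inverse contribute nothing, by the cocycle identity for
  these two letters and the rest of the word.\<close>

lemma word_chain_push_letter:
  assumes w: "w \<in> carrier (free_group S)" and l: "fst l \<in> S"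
  shows "homologous G (word_chain (push_letter l w)) (letter_chain l + word_chain w + frag_of [p [l], p w])"
proof (cases "w \<noteq> [] \<and> hd w = letter_inv l")
  case False
  then have "push_letter l w = l # w"
    by (auto simp: push_letter_def)
  then show ?thesis
    by simp
next
  case True
  then obtain v where v: "w = letter_inv l # v"
    by (metis list.collapse)
  let ?x = "p [l]" and ?y = "p [letter_inv l]" and ?c = "\<lambda>a b. frag_of [a, b]"
  have vc: "v \<in> carrier (free_group S)"
    using w free_group_Cons v by blast
  have xy: "?x \<in> carrier G" "?y \<in> carrier G" "?x \<otimes> ?y = \<one>" "p v \<in> carrier G"
    using l p_letter_inv [of l] vc by auto
  have "p w = ?y \<otimes> p v"
    using p_push_letter [OF vc, of "letter_inv l"] w l
    by (auto simp: v push_letter_def carrier_free_group reduced_word_Cons)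
  then have *: "homologous G (?c ?y (p v) + ?c ?x (p w)) (?c \<one> (p v) + ?c ?x ?y)"
    using H.bar_cocycle [OF xy(1,2,4)] xy by simp
  \<comment> \<open>The right-hand side is 0: the constant - [1|1] absorbs the degenerate term
    [1|p v], already replaced by [1|1].\<close>
  have "homologous G (letter_chain l + letter_chain (letter_inv l) + ?c ?x ?y
      + (?c ?y (p v) + ?c ?x (p w)) - ?c ?x ?y)
      (- ?c \<one> \<one> + (?c \<one> \<one> + ?c ?x ?y) - ?c ?x ?y)"
    by (intro homologous_diff homologous_add letter_chain_inverse l homologous_refl
        homologous_trans [OF *] H.bar_one_left xy)
  from homologous_add [OF homologous_refl [of G "word_chain v"] homologous_sym [OF this]]
  have "homologous G (word_chain v)
      (letter_chain l + (letter_chain (letter_inv l) + word_chain v + ?c ?y (p v)) + ?c ?x (p w))"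
    by (simp add: algebra_simps)
  moreover have "push_letter l w = v" "word_chain w = letter_chain (letter_inv l) + word_chain v + ?c ?y (p v)"
    by (simp_all add: v push_letter_def)
  ultimately show ?thesis
    by simp
qed

text \<open>Peeling a letter off \<open>u\<close> leaves two bar terms, which the cocycle identity
  for (p [l], p u, p v) regroups.\<close>

lemma word_chain_mult:
  assumes "u \<in> carrier (free_group S)" and v: "v \<in> carrier (free_group S)"
  shows "homologous G (word_chain (u \<otimes>\<^bsub>free_group S\<^esub> v)) (word_chain u + word_chain v + frag_of [p u, p v])"
  using assms(1)
proof (induction u)
  case Nil
  have "homologous G (word_chain v + (frag_of [\<one>, \<one>] - frag_of [\<one>, \<one>]))
                     (word_chain v + (frag_of [\<one>, p v] - frag_of [\<one>, \<one>]))"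
    by (intro homologous_add homologous_refl homologous_diff homologous_sym [OF H.bar_one_left] hom_closed v)
  then show ?case
    by (simp add: mult_free_group algebra_simps)
next
  case (Cons l u)
  let ?c = "\<lambda>a b. frag_of [a, b]"
  have u: "u \<in> carrier (free_group S)" and l: "fst l \<in> S"
    using Cons.prems by (auto simp: carrier_free_group reduced_word_Cons)
  have uv: "u \<otimes>\<^bsub>free_group S\<^esub> v \<in> carrier (free_group S)"
    using u v by simp
  have pl: "p (l # u) = p [l] \<otimes> p u"
    using free_group_Cons(1) [OF Cons.prems] hom_mult [OF letter_carrier [OF l] u] by simp
  have "homologous G (word_chain ((l # u) \<otimes>\<^bsub>free_group S\<^esub> v))
      (letter_chain l + word_chain (u \<otimes>\<^bsub>free_group S\<^esub> v) + ?c (p [l]) (p (u \<otimes>\<^bsub>free_group S\<^esub> v)))"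
    using word_chain_push_letter [OF uv l] by (simp add: mult_free_group)
  also have "homologous G \<dots> (letter_chain l + (word_chain u + word_chain v + ?c (p u) (p v))
      + ?c (p [l]) (p (u \<otimes>\<^bsub>free_group S\<^esub> v)))"
    by (intro homologous_add homologous_refl Cons.IH u)
  also have "\<dots> = letter_chain l + word_chain u + word_chain v + (?c (p u) (p v) + ?c (p [l]) (p u \<otimes> p v))"
    using u v by (simp add: algebra_simps)
  also have "homologous G \<dots> (letter_chain l + word_chain u + word_chain v + (?c (p [l] \<otimes> p u) (p v) + ?c (p [l]) (p u)))"
    by (intro homologous_add homologous_refl H.bar_cocycle) (use u v l in auto)
  also have "\<dots> = word_chain (l # u) + word_chain v + ?c (p (l # u)) (p v)"
    by (simp add: pl algebra_simps)
  finally show ?case .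
qed

end

section \<open>Hopf's formula\<close>

text \<open>Here \<open>Q\<close> stands for \<open>F/[F,R]\<close> and \<open>A\<close> for \<open>F/[F,F]\<close>, where \<open>R\<close> is the kernel of \<open>p\<close>. Freeness of \<open>F\<close>
  enters only through \<open>chain\<close>.\<close>

locale hopf_data =
  p: group_hom F G p + q: group_hom F Q q + ab: group_hom F A ab
  for F :: "('f, 'e) monoid_scheme" (structure) and G :: "('g, 'd) monoid_scheme" and p
    and Q :: "('q, 'c) monoid_scheme" and q
    and A :: "('a, 'b) monoid_scheme" and ab +
  fixes chain :: "'f \<Rightarrow> 'g list \<Rightarrow>\<^sub>0 int"
  assumes p_surj: "p ` carrier F = carrier G"
    and kernel_q: "kernel F Q q = commutator_subgroup F (carrier F) (kernel F G p)"
    and comm_A: "comm_group A"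
    and kernel_ab: "kernel F A ab = commutator_subgroup F (carrier F) (carrier F)"
    and chain_carrier: "f \<in> carrier F \<Longrightarrow> chain f \<in> bar_chains G 2"
    and chain_one: "chain \<one> = - frag_of [\<one>\<^bsub>G\<^esub>, \<one>\<^bsub>G\<^esub>]"
    and chain_mult: "\<lbrakk>f \<in> carrier F; g \<in> carrier F\<rbrakk> \<Longrightarrow>
          homologous G (chain (f \<otimes> g)) (chain f + chain g + frag_of [p f, p g])"
begin

abbreviation R where "R \<equiv> kernel F G p"

abbreviation D where "D \<equiv> kernel F A ab"

definition lift :: "'g \<Rightarrow> 'f" where
  "lift x = (SOME f. f \<in> carrier F \<and> p f = x)"

text \<open>The classical factor set of the extension of G by R. The section is arbitrary, so
  \<open>factor_set\<close> of (1, 1) is \<open>lift\<close> of 1 and need not be trivial.\<close>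

definition factor_set :: "'g \<Rightarrow> 'g \<Rightarrow> 'f" where
  "factor_set x y = lift x \<otimes> lift y \<otimes> inv lift (x \<otimes>\<^bsub>G\<^esub> y)"

definition QR where "QR = Q\<lparr>carrier := q ` R\<rparr>"

text \<open>The homomorphism extending the factor set from the free basis of 2-chains. It is chosen,
  since the universal property of \<open>free_Abelian_group\<close> yields existence only.\<close>

definition \<theta> :: "('g list \<Rightarrow>\<^sub>0 int) \<Rightarrow> 'q" where
  "\<theta> = (SOME h. h \<in> hom (bar_chain_group G 2) QR \<and>
              (\<forall>x\<in>carrier G. \<forall>y\<in>carrier G. h (frag_of [x, y]) = q (factor_set x y)))"

text \<open>On R the map p is trivial, so \<open>chain\<close> is additive there up to the constant
  [1|1]; adding that constant makes it additive modulo boundaries.\<close>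

definition rel_chain :: "'f \<Rightarrow> 'g list \<Rightarrow>\<^sub>0 int" where
  "rel_chain r = chain r + frag_of [\<one>\<^bsub>G\<^esub>, \<one>\<^bsub>G\<^esub>]"

lemma R_carrier: "r \<in> R \<Longrightarrow> r \<in> carrier F"
  by (simp add: kernel_def)

lemma R_p: "r \<in> R \<Longrightarrow> p r = \<one>\<^bsub>G\<^esub>"
  by (simp add: kernel_def)

lemma subgroup_R: "subgroup R F"
  by (rule p.subgroup_kernel)

lemma q_central:
  assumes "r \<in> R" "f \<in> carrier F"
  shows "q f \<otimes>\<^bsub>Q\<^esub> q r = q r \<otimes>\<^bsub>Q\<^esub> q f"
proof -
  have "group_commutator F f r \<in> kernel F Q q"
    unfolding kernel_q using assms by (intro p.G.group_commutator_in_subgroup)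
  from q.commute_if_commutator_kernel [OF this assms(2) R_carrier [OF assms(1)]] show ?thesis ..
qed

lemma lift: "x \<in> carrier G \<Longrightarrow> lift x \<in> carrier F" "x \<in> carrier G \<Longrightarrow> p (lift x) = x"
proof -
  assume "x \<in> carrier G"
  then have "\<exists>f. f \<in> carrier F \<and> p f = x"
    using p_surj by (metis imageE)
  then have "lift x \<in> carrier F \<and> p (lift x) = x"
    unfolding lift_def by (rule someI_ex)
  then show "lift x \<in> carrier F" "p (lift x) = x"
    by auto
qed

lemma factor_set_R:
  assumes "x \<in> carrier G" "y \<in> carrier G"
  shows "factor_set x y \<in> R"
  using assms by (simp add: factor_set_def kernel_def lift)

lemma factor_set_mult:
  assumes "x \<in> carrier G" "y \<in> carrier G"
  shows "factor_set x y \<otimes> lift (x \<otimes>\<^bsub>G\<^esub> y) = lift x \<otimes> lift y"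
  using assms by (simp add: factor_set_def lift p.G.m_assoc)

lemma comm_group_QR: "comm_group QR"
proof -
  have "subgroup (q ` R) Q"
    by (rule q.subgroup_img_is_subgroup [OF subgroup_R])
  then have "group QR"
    unfolding QR_def by (rule q.H.subgroup_imp_group)
  then show ?thesis
    by (rule group.group_comm_groupI) (auto simp: QR_def q_central R_carrier)
qed

lemma carrier_QR: "carrier QR = q ` R"
  by (simp add: QR_def)

lemma mult_QR: "x \<otimes>\<^bsub>QR\<^esub> y = x \<otimes>\<^bsub>Q\<^esub> y"
  by (simp add: QR_def)

lemma one_QR: "\<one>\<^bsub>QR\<^esub> = \<one>\<^bsub>Q\<^esub>"
  by (simp add: QR_def)

lemma QR_subset: "x \<in> q ` R \<Longrightarrow> x \<in> carrier Q"
  using R_carrier by auto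

section \<open>Evaluation of bar 2-chains in R/[F,R]\<close>

lemma \<theta>_hom: "\<theta> \<in> hom (bar_chain_group G 2) QR" (is ?A)
  and \<theta>_of: "x \<in> carrier G \<Longrightarrow> y \<in> carrier G \<Longrightarrow> \<theta> (frag_of [x, y]) = q (factor_set x y)"
proof -
  interpret QR: comm_group QR
    by (rule comm_group_QR)
  let ?T = "{gs. length gs = 2 \<and> set gs \<subseteq> carrier G}"
  have "(\<lambda>gs. q (factor_set (gs ! 0) (gs ! 1))) ` ?T \<subseteq> carrier QR"
  proof clarify
    fix gs :: "'g list" assume "length gs = 2" "set gs \<subseteq> carrier G"
    then have "gs ! 0 \<in> carrier G" "gs ! 1 \<in> carrier G"
      by (auto simp: subset_iff)
    then show "q (factor_set (gs ! 0) (gs ! 1)) \<in> carrier QR"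
      by (simp add: carrier_QR factor_set_R)
  qed
  from QR.free_Abelian_group_universal [OF this]
  obtain h where "h \<in> hom (free_Abelian_group ?T) QR"
    "\<And>gs. gs \<in> ?T \<Longrightarrow> h (frag_of gs) = q (factor_set (gs ! 0) (gs ! 1))"
    by blast
  then have "\<exists>h. h \<in> hom (bar_chain_group G 2) QR \<and>
              (\<forall>x\<in>carrier G. \<forall>y\<in>carrier G. h (frag_of [x, y]) = q (factor_set x y))"
    unfolding bar_chain_group_def by (intro exI [of _ h]) simp
  then have *: "\<theta> \<in> hom (bar_chain_group G 2) QR \<and>
              (\<forall>x\<in>carrier G. \<forall>y\<in>carrier G. \<theta> (frag_of [x, y]) = q (factor_set x y))"
    unfolding \<theta>_def by (rule someI_ex)
  then show ?A
    by blast
  show "x \<in> carrier G \<Longrightarrow> y \<in> carrier G \<Longrightarrow> \<theta> (frag_of [x, y]) = q (factor_set x y)"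
    using * by blast
qed

lemma \<theta>_carrier: "c \<in> bar_chains G 2 \<Longrightarrow> \<theta> c \<in> q ` R"
  using \<theta>_hom by (auto simp: hom_def carrier_QR)

lemma \<theta>_add: "a \<in> bar_chains G 2 \<Longrightarrow> b \<in> bar_chains G 2 \<Longrightarrow> \<theta> (a + b) = \<theta> a \<otimes>\<^bsub>Q\<^esub> \<theta> b"
  using hom_mult [OF \<theta>_hom] by (simp add: mult_QR)

lemma \<theta>_0: "\<theta> 0 = \<one>\<^bsub>Q\<^esub>"
  using hom_one [OF \<theta>_hom] comm_group_QR
  by (simp add: group_bar_chain_group one_QR comm_group.axioms(2))

lemma \<theta>_diff:
  assumes "a \<in> bar_chains G 2" "b \<in> bar_chains G 2"
  shows "\<theta> (a - b) = \<theta> a \<otimes>\<^bsub>Q\<^esub> inv\<^bsub>Q\<^esub> \<theta> b"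
proof -
  have "\<theta> (a - b) \<otimes>\<^bsub>Q\<^esub> \<theta> b = \<theta> a"
    using \<theta>_add [OF bar_chains_diff [OF assms] assms(2)] by simp
  moreover have "\<theta> (a - b) \<in> carrier Q" "\<theta> a \<in> carrier Q" "\<theta> b \<in> carrier Q"
    using assms bar_chains_diff \<theta>_carrier QR_subset by metis+
  ultimately show ?thesis
    by (metis q.H.inv_solve_right)
qed

lemma lift_carrier_q: "x \<in> carrier G \<Longrightarrow> q (lift x) \<in> carrier Q"
  by (simp add: lift)

lemma \<theta>_of_mult:
  assumes "x \<in> carrier G" "y \<in> carrier G"
  shows "\<theta> (frag_of [x, y]) \<otimes>\<^bsub>Q\<^esub> q (lift (x \<otimes>\<^bsub>G\<^esub> y)) = q (lift x) \<otimes>\<^bsub>Q\<^esub> q (lift y)"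
proof -
  have "q (factor_set x y \<otimes> lift (x \<otimes>\<^bsub>G\<^esub> y)) = q (lift x \<otimes> lift y)"
    using factor_set_mult assms by simp
  then show ?thesis
    using assms by (simp add: \<theta>_of R_carrier factor_set_R lift)
qed

lemma \<theta>_central:
  assumes "c \<in> bar_chains G 2" "f \<in> carrier F"
  shows "q f \<otimes>\<^bsub>Q\<^esub> \<theta> c = \<theta> c \<otimes>\<^bsub>Q\<^esub> q f"
  using \<theta>_carrier [OF assms(1)] q_central assms(2) by auto

text \<open>The cocycle identity of a factor set, on the basis chains [x|y|z]. It holds because
  multiplication in Q is associative and the values are central.\<close>

lemma \<theta>_boundary:
  assumes "b \<in> bar_boundaries G 2"
  shows "\<theta> b = \<one>\<^bsub>Q\<^esub>"
proof -
  obtain c where c: "c \<in> bar_chains G 3" "b = bar_boundary G c"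
    using assms by (auto simp: bar_boundaries_def)
  have "\<theta> (bar_boundary G c) = \<one>\<^bsub>Q\<^esub>"
    using c(1)
  proof (induction rule: bar_chains_induct)
    case (of gs)
    then obtain x y z where gs: "gs = [x, y, z]" and
      xyz: "x \<in> carrier G" "y \<in> carrier G" "z \<in> carrier G"
      by (auto simp: length_Suc_conv numeral_3_eq_3)
    let ?t = "\<lambda>x y. \<theta> (frag_of [x, y])" and ?s = "\<lambda>x. q (lift x)"
    let ?xyz = "?s (x \<otimes>\<^bsub>G\<^esub> y \<otimes>\<^bsub>G\<^esub> z)"
    have tc: "frag_of [x, y] \<in> bar_chains G 2" "?t x y \<in> carrier Q"
      if "x \<in> carrier G" "y \<in> carrier G" for x y
      using that \<theta>_carrier [of "frag_of [x, y]"] QR_subset by (auto simp: bar_chains_of)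
    note [simp] = xyz tc lift_carrier_q
    \<comment> \<open>Both sides equal s(x) s(y) s(z), once bracketed from the right and once from
      the left; the common factor s(xyz) cancels afterwards.\<close>
    have *: "(?t y z \<otimes>\<^bsub>Q\<^esub> ?t x (y \<otimes>\<^bsub>G\<^esub> z)) \<otimes>\<^bsub>Q\<^esub> ?xyz = (?t (x \<otimes>\<^bsub>G\<^esub> y) z \<otimes>\<^bsub>Q\<^esub> ?t x y) \<otimes>\<^bsub>Q\<^esub> ?xyz"
    proof -
      have "(?t y z \<otimes>\<^bsub>Q\<^esub> ?t x (y \<otimes>\<^bsub>G\<^esub> z)) \<otimes>\<^bsub>Q\<^esub> ?xyz = ?t y z \<otimes>\<^bsub>Q\<^esub> (?s x \<otimes>\<^bsub>Q\<^esub> ?s (y \<otimes>\<^bsub>G\<^esub> z))"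
        using \<theta>_of_mult [of x "y \<otimes>\<^bsub>G\<^esub> z"] by (simp add: q.H.m_assoc p.H.m_assoc)
      also have "\<dots> = (?t y z \<otimes>\<^bsub>Q\<^esub> ?s x) \<otimes>\<^bsub>Q\<^esub> ?s (y \<otimes>\<^bsub>G\<^esub> z)"
        by (simp add: q.H.m_assoc)
      also have "\<dots> = (?s x \<otimes>\<^bsub>Q\<^esub> ?t y z) \<otimes>\<^bsub>Q\<^esub> ?s (y \<otimes>\<^bsub>G\<^esub> z)"
        using \<theta>_central [of "frag_of [y, z]" "lift x"] by (simp add: lift)
      also have "\<dots> = ?s x \<otimes>\<^bsub>Q\<^esub> (?s y \<otimes>\<^bsub>Q\<^esub> ?s z)"
        using \<theta>_of_mult [of y z] by (simp add: q.H.m_assoc)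
      also have "\<dots> = (?t x y \<otimes>\<^bsub>Q\<^esub> ?s (x \<otimes>\<^bsub>G\<^esub> y)) \<otimes>\<^bsub>Q\<^esub> ?s z"
        using \<theta>_of_mult [of x y] by (simp add: q.H.m_assoc)
      also have "\<dots> = ?t x y \<otimes>\<^bsub>Q\<^esub> (?t (x \<otimes>\<^bsub>G\<^esub> y) z \<otimes>\<^bsub>Q\<^esub> ?xyz)"
        using \<theta>_of_mult [of "x \<otimes>\<^bsub>G\<^esub> y" z] by (simp add: q.H.m_assoc)
      also have "\<dots> = (?t x y \<otimes>\<^bsub>Q\<^esub> ?t (x \<otimes>\<^bsub>G\<^esub> y) z) \<otimes>\<^bsub>Q\<^esub> ?xyz"
        by (simp add: q.H.m_assoc)
      also have "?t x y \<otimes>\<^bsub>Q\<^esub> ?t (x \<otimes>\<^bsub>G\<^esub> y) z = ?t (x \<otimes>\<^bsub>G\<^esub> y) z \<otimes>\<^bsub>Q\<^esub> ?t x y"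
        using \<theta>_central [of "frag_of [x \<otimes>\<^bsub>G\<^esub> y, z]" "factor_set x y"]
        by (simp add: \<theta>_of R_carrier factor_set_R)
      finally show ?thesis .
    qed
    then have "?t y z \<otimes>\<^bsub>Q\<^esub> ?t x (y \<otimes>\<^bsub>G\<^esub> z) = ?t (x \<otimes>\<^bsub>G\<^esub> y) z \<otimes>\<^bsub>Q\<^esub> ?t x y"
      by simp
    moreover have "bar_boundary G (frag_of gs)
        = (frag_of [y, z] + frag_of [x, y \<otimes>\<^bsub>G\<^esub> z]) - (frag_of [x \<otimes>\<^bsub>G\<^esub> y, z] + frag_of [x, y])"
      by (simp add: gs bar_boundary_def bar_boundary_gen_3)
    ultimately show ?case
      by (simp add: \<theta>_diff \<theta>_add bar_chains_add)
  qed (simp_all add: \<theta>_0 bar_boundary_diff \<theta>_diff p.H.bar_boundary_3_carrier)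
  then show ?thesis
    using c by simp
qed

lemma homologous_\<theta>:
  assumes "homologous G a b" "a \<in> bar_chains G 2" "b \<in> bar_chains G 2"
  shows "\<theta> a = \<theta> b"
proof -
  have "\<theta> a \<otimes>\<^bsub>Q\<^esub> inv\<^bsub>Q\<^esub> \<theta> b = \<one>\<^bsub>Q\<^esub>"
    using \<theta>_boundary [of "a - b"] \<theta>_diff assms by (simp add: homologous_def)
  moreover have "\<theta> a \<in> carrier Q" "\<theta> b \<in> carrier Q"
    using assms \<theta>_carrier QR_subset by metis+
  ultimately show ?thesis
    by (metis q.H.inv_closed q.H.inv_equality q.H.inv_inv)
qed

subsection \<open>Recovering a relator from its chain\<close>

text \<open>\<open>section_hom\<close> and \<open>q\<close> are homomorphisms \<open>F \<rightarrow> Q\<close> over \<open>G\<close>. They differ by a homomorphism into the central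
  subgroup \<open>R/[F,R]\<close>, so they agree on \<open>[F,F]\<close>.\<close>

definition section_hom :: "'f \<Rightarrow> 'q" where
  "section_hom f = \<theta> (chain f) \<otimes>\<^bsub>Q\<^esub> q (lift (p f))"

lemma section_hom_carrier: "f \<in> carrier F \<Longrightarrow> section_hom f \<in> carrier Q"
  using \<theta>_carrier [OF chain_carrier] QR_subset by (simp add: section_hom_def lift)

text \<open>\<open>chain (f \<otimes> g)\<close> exceeds the sum by [p f|p g], and the value of this
  term is exactly the factor by which s(p f) s(p g) differs from s(p f p g).\<close>

lemma section_hom_mult:
  assumes fg: "f \<in> carrier F" "g \<in> carrier F"
  shows "section_hom (f \<otimes> g) = section_hom f \<otimes>\<^bsub>Q\<^esub> section_hom g"
proof -
  let ?t = "\<theta> (frag_of [p f, p g])" and ?f = "\<theta> (chain f)" and ?g = "\<theta> (chain g)"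
  have c: "frag_of [p f, p g] \<in> bar_chains G 2"
    using fg by (simp add: bar_chains_of)
  have tc: "?t \<in> carrier Q" "?f \<in> carrier Q" "?g \<in> carrier Q"
    using c fg \<theta>_carrier QR_subset chain_carrier by metis+
  have "\<theta> (chain (f \<otimes> g)) = \<theta> (chain f + chain g + frag_of [p f, p g])"
    using fg c by (intro homologous_\<theta> chain_mult) (auto intro: chain_carrier bar_chains_intros)
  then have "\<theta> (chain (f \<otimes> g)) = ?f \<otimes>\<^bsub>Q\<^esub> ?g \<otimes>\<^bsub>Q\<^esub> ?t"
    using fg c by (simp add: \<theta>_add chain_carrier bar_chains_add)
  then have "section_hom (f \<otimes> g) = ?f \<otimes>\<^bsub>Q\<^esub> ?g \<otimes>\<^bsub>Q\<^esub> (?t \<otimes>\<^bsub>Q\<^esub> q (lift (p f \<otimes>\<^bsub>G\<^esub> p g)))"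
    using fg tc by (simp add: section_hom_def lift q.H.m_assoc)
  also have "\<dots> = ?f \<otimes>\<^bsub>Q\<^esub> (?g \<otimes>\<^bsub>Q\<^esub> q (lift (p f))) \<otimes>\<^bsub>Q\<^esub> q (lift (p g))"
    using fg tc by (simp add: \<theta>_of_mult lift q.H.m_assoc)
  also have "?g \<otimes>\<^bsub>Q\<^esub> q (lift (p f)) = q (lift (p f)) \<otimes>\<^bsub>Q\<^esub> ?g"
    using fg by (simp add: \<theta>_central chain_carrier lift)
  finally show ?thesis
    using fg tc by (simp add: section_hom_def lift q.H.m_assoc)
qed

definition defect :: "'f \<Rightarrow> 'q" where
  "defect f = q f \<otimes>\<^bsub>Q\<^esub> inv\<^bsub>Q\<^esub> section_hom f"

lemma defect_carrier:
  assumes f: "f \<in> carrier F"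
  shows "defect f \<in> q ` R"
proof -
  obtain r where r: "r \<in> R" "\<theta> (chain f) = q r"
    using \<theta>_carrier [OF chain_carrier [OF f]] by auto
  then have "defect f = q (f \<otimes> inv (r \<otimes> lift (p f)))"
    using f by (simp add: defect_def section_hom_def R_carrier lift)
  moreover have "f \<otimes> inv (r \<otimes> lift (p f)) \<in> R"
    using f r by (simp add: kernel_def lift)
  ultimately show ?thesis
    by auto
qed

text \<open>A quotient of two homomorphisms is multiplicative here because its values are central
  and can be moved past \<open>q f\<close>.\<close>

lemma defect_mult:
  assumes fg: "f \<in> carrier F" "g \<in> carrier F"
  shows "defect (f \<otimes> g) = defect f \<otimes>\<^bsub>Q\<^esub> defect g"
proof -
  have c: "section_hom f \<in> carrier Q" "section_hom g \<in> carrier Q" "defect g \<in> carrier Q"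
    using fg section_hom_carrier defect_carrier QR_subset by auto
  have "defect (f \<otimes> g) = q f \<otimes>\<^bsub>Q\<^esub> (defect g \<otimes>\<^bsub>Q\<^esub> inv\<^bsub>Q\<^esub> section_hom f)"
    using fg c unfolding defect_def by (simp add: section_hom_mult q.H.inv_mult_group q.H.m_assoc)
  also have "\<dots> = (q f \<otimes>\<^bsub>Q\<^esub> defect g) \<otimes>\<^bsub>Q\<^esub> inv\<^bsub>Q\<^esub> section_hom f"
    using fg c by (simp add: q.H.m_assoc)
  also have "q f \<otimes>\<^bsub>Q\<^esub> defect g = defect g \<otimes>\<^bsub>Q\<^esub> q f"
    using defect_carrier [OF fg(2)] q_central fg by auto
  also have "(defect g \<otimes>\<^bsub>Q\<^esub> q f) \<otimes>\<^bsub>Q\<^esub> inv\<^bsub>Q\<^esub> section_hom f = defect g \<otimes>\<^bsub>Q\<^esub> defect f"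
    using fg c by (simp add: defect_def q.H.m_assoc)
  also have "\<dots> = defect f \<otimes>\<^bsub>Q\<^esub> defect g"
    using defect_carrier [OF fg(1)] defect_carrier [OF fg(2)] q_central R_carrier by auto
  finally show ?thesis .
qed

lemma \<theta>_rel_chain:
  assumes "r \<in> R" "r \<in> D"
  shows "\<theta> (rel_chain r) = q r"
proof -
  have r: "r \<in> carrier F"
    using assms R_carrier by blast
  have one: "frag_of [\<one>\<^bsub>G\<^esub>, \<one>\<^bsub>G\<^esub>] \<in> bar_chains G 2"
    by (simp add: bar_chains_of)
  have "defect \<in> hom F QR"
    by (rule homI) (auto simp: defect_carrier defect_mult carrier_QR mult_QR)
  then have "defect r = \<one>\<^bsub>Q\<^esub>"
    using p.G.hom_commutator_trivial [OF _ comm_group_QR assms(2) [unfolded kernel_ab]] by (simp add: one_QR)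
  then have "q r = section_hom r"
    unfolding defect_def using r section_hom_carrier
    by (metis q.H.inv_closed q.H.inv_equality q.H.inv_inv q.hom_closed)
  also have "\<dots> = \<theta> (chain r) \<otimes>\<^bsub>Q\<^esub> q (lift \<one>\<^bsub>G\<^esub>)"
    by (simp add: section_hom_def R_p assms)
  \<comment> \<open>The section is not normalised, but its value at 1 is a value of the factor set
    and accounts for the summand [1|1] of \<open>rel_chain\<close>.\<close>
  also have "lift \<one>\<^bsub>G\<^esub> = factor_set \<one>\<^bsub>G\<^esub> \<one>\<^bsub>G\<^esub>"
    by (simp add: factor_set_def lift p.G.m_assoc)
  also have "\<theta> (chain r) \<otimes>\<^bsub>Q\<^esub> q (factor_set \<one>\<^bsub>G\<^esub> \<one>\<^bsub>G\<^esub>) = \<theta> (rel_chain r)"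
    using r one by (simp add: rel_chain_def \<theta>_add \<theta>_of chain_carrier)
  finally show ?thesis ..
qed

lemma rel_chain_cycle:
  assumes "r \<in> R" "r \<in> D"
  shows "rel_chain r \<in> bar_cycles G 2"
proof -
  have r: "r \<in> carrier F"
    using assms R_carrier by blast
  have one: "frag_of [\<one>\<^bsub>G\<^esub>, \<one>\<^bsub>G\<^esub>] \<in> bar_chains G 2"
    by (simp add: bar_chains_of)
  \<comment> \<open>The term [p f] compensates the failure of the boundary of \<open>chain\<close>
    to be additive, since d[g|h] = [h] - [gh] + [g]. On an element of both R and [F,F] it leaves
    d(chain r) = - [1] = - d[1|1].\<close>
  have "(\<lambda>f. bar_boundary G (chain f) + frag_of [p f]) \<in> hom F (bar_chain_group G 1)"
  proof (rule homI)
    fix f assume "f \<in> carrier F"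
    then show "bar_boundary G (chain f) + frag_of [p f] \<in> bar_chains G 1"
      by (intro bar_chains_add p.H.bar_boundary_2_carrier chain_carrier) (auto simp: bar_chains_of)
  next
    fix f g assume "f \<in> carrier F" "g \<in> carrier F"
    then show "bar_boundary G (chain (f \<otimes> g)) + frag_of [p (f \<otimes> g)]
      = (bar_boundary G (chain f) + frag_of [p f])
        \<otimes>\<^bsub>bar_chain_group G 1\<^esub> (bar_boundary G (chain g) + frag_of [p g])"
      using p.H.homologous_bar_boundary [OF chain_mult [of f g]]
      by (simp add: bar_boundary_add bar_boundary_def frag_extend_add bar_boundary_gen_2)
  qed
  from p.G.hom_commutator_trivial [OF this comm_group_bar_chain_group assms(2) [unfolded kernel_ab]]
  have "bar_boundary G (rel_chain r) = 0"
    using R_p [OF assms(1)]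
    by (simp add: rel_chain_def bar_boundary_add bar_boundary_def frag_extend_add bar_boundary_gen_2)
  moreover have "rel_chain r \<in> bar_chains G 2"
    unfolding rel_chain_def by (intro bar_chains_add chain_carrier r one)
  ultimately show ?thesis
    by (simp add: bar_cycles_def)
qed

subsection \<open>Recovering a cycle from its relator\<close>

lemma rel_chain_one: "rel_chain \<one> = 0"
  by (simp add: rel_chain_def chain_one)

lemma rel_chain_mult:
  assumes "r \<in> R" "s \<in> R"
  shows "homologous G (rel_chain (r \<otimes> s)) (rel_chain r + rel_chain s)"
  using homologous_add [OF chain_mult [of r s] homologous_refl [of G "frag_of [\<one>\<^bsub>G\<^esub>, \<one>\<^bsub>G\<^esub>]"]] assms
  by (simp add: rel_chain_def R_carrier R_p algebra_simps)

lemma rel_chain_inv: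
  assumes "r \<in> R"
  shows "homologous G (rel_chain (inv r)) (- rel_chain r)"
proof -
  have "inv r \<in> R" "r \<in> carrier F"
    using assms subgroup_R by (auto simp: subgroup.m_inv_closed R_carrier)
  then have "homologous G 0 (rel_chain r + rel_chain (inv r))"
    using rel_chain_mult [of r "inv r"] assms by (simp add: rel_chain_one)
  from homologous_diff [OF homologous_sym [OF this] homologous_refl [of G "rel_chain r"]] show ?thesis
    by simp
qed

lemma chain_mult_R:
  assumes r: "r \<in> R" and f: "f \<in> carrier F"
  shows "homologous G (chain (r \<otimes> f)) (rel_chain r + chain f)"
proof -
  have "homologous G (chain (r \<otimes> f)) (chain r + chain f + frag_of [\<one>\<^bsub>G\<^esub>, p f])"
    using chain_mult [of r f] r f by (simp add: R_carrier R_p)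
  also have "homologous G \<dots> (chain r + chain f + frag_of [\<one>\<^bsub>G\<^esub>, \<one>\<^bsub>G\<^esub>])"
    by (intro homologous_add homologous_refl p.H.bar_one_left) (use f in simp)
  finally show ?thesis
    by (simp add: rel_chain_def algebra_simps)
qed

text \<open>Multiplication by r changes \<open>chain\<close> by the same amount on the right as on
  the left; this symmetry makes \<open>rel_chain\<close> trivial on commutators [f, r].\<close>

lemma chain_mult_R':
  assumes r: "r \<in> R" and f: "f \<in> carrier F"
  shows "homologous G (chain (f \<otimes> r)) (rel_chain r + chain f)"
proof -
  have "homologous G (chain (f \<otimes> r)) (chain f + chain r + frag_of [p f, \<one>\<^bsub>G\<^esub>])"
    using chain_mult [of f r] r f by (simp add: R_carrier R_p)
  also have "homologous G \<dots> (chain f + chain r + frag_of [\<one>\<^bsub>G\<^esub>, \<one>\<^bsub>G\<^esub>])"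
    by (intro homologous_add homologous_refl p.H.bar_one_right) (use f in simp)
  finally show ?thesis
    by (simp add: rel_chain_def algebra_simps)
qed

text \<open>Hence \<open>rel_chain\<close> is well defined on R/[F,R] modulo boundaries. From [f, r]
  (r f) = f r the chain of [f, r] is the difference of two homologous chains.\<close>

lemma rel_chain_kernel_q:
  assumes "k \<in> kernel F Q q"
  shows "homologous G (rel_chain k) 0"
proof -
  let ?N = "{r \<in> R. homologous G (rel_chain r) 0}"
  have "subgroup ?N F"
  proof (rule p.G.subgroupI)
    show "?N \<subseteq> carrier F"
      by (auto simp: kernel_def)
    have "\<one> \<in> ?N"
      by (simp add: rel_chain_one kernel_def)
    then show "?N \<noteq> {}"
      by blast
  next
    fix r assume r: "r \<in> ?N"
    then have "homologous G (- rel_chain r) 0"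
      using homologous_minus by fastforce
    then show "inv r \<in> ?N"
      using homologous_trans [OF rel_chain_inv] r subgroup_R by (auto simp: subgroup.m_inv_closed)
  next
    fix r s assume rs: "r \<in> ?N" "s \<in> ?N"
    then have "homologous G (rel_chain r + rel_chain s) 0"
      using homologous_add by fastforce
    then show "r \<otimes> s \<in> ?N"
      using homologous_trans [OF rel_chain_mult] rs subgroup_R by (auto simp: subgroup.m_closed)
  qed
  moreover have "group_commutator F f r \<in> ?N" if f: "f \<in> carrier F" and r: "r \<in> R" for f r
  proof -
    let ?x = "group_commutator F f r"
    have rc: "r \<in> carrier F"
      by (rule R_carrier [OF r])
    have x: "?x \<in> R"
      using f rc R_p [OF r] by (simp add: kernel_def group_commutator_def)
    have *: "?x \<otimes> (r \<otimes> f) = f \<otimes> r"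
    proof -
      have c: "inv a \<otimes> (a \<otimes> z) = z" if "a \<in> carrier F" "z \<in> carrier F" for a z
        using that by (simp flip: p.G.m_assoc)
      show ?thesis
        using f rc by (simp add: group_commutator_def p.G.m_assoc c)
    qed
    have "homologous G (rel_chain ?x + (rel_chain r + chain f)) (rel_chain ?x + chain (r \<otimes> f))"
      using r f by (intro homologous_add homologous_refl homologous_sym [OF chain_mult_R])
    also have "homologous G \<dots> (chain (f \<otimes> r))"
      using chain_mult_R [OF x, of "r \<otimes> f"] f rc by (simp add: homologous_sym *)
    also have "homologous G \<dots> (rel_chain r + chain f)"
      by (rule chain_mult_R' [OF r f])
    finally show ?thesis
      using x homologous_diff [OF _ homologous_refl [of G "rel_chain r + chain f"]] by fastforce
  qed
  ultimately have "kernel F Q q \<subseteq> ?N"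
    unfolding kernel_q by (intro p.G.commutator_subgroup_minimal)
  then show ?thesis
    using assms by blast
qed

text \<open>The inductive form of the statement needed for cycles: \<open>B\<close> sends [x] to the
  abelianised lift of x and the \<open>frag_extend\<close> term sends [x] to the chain of that lift.
  Both are applied to the boundary of c, so that r lies in [F,F] and \<open>rel_chain r\<close> is
  homologous to c as soon as c is a cycle.\<close>

lemma chain_relator:
  fixes B :: "('g list \<Rightarrow>\<^sub>0 int) \<Rightarrow> 'a"
  assumes B: "B \<in> hom (bar_chain_group G 1) A" "\<And>x. x \<in> carrier G \<Longrightarrow> B (frag_of [x]) = ab (lift x)"
  assumes "c \<in> bar_chains G 2"
  shows "\<exists>r\<in>R. \<theta> c = q r \<and> ab r = B (bar_boundary G c) \<and>
     homologous G (rel_chain r) (c + frag_extend (\<lambda>gs. chain (lift (hd gs))) (bar_boundary G c))"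
proof -
  interpret B: group_hom "bar_chain_group G 1" A B
    using B(1) ab.H.is_group by (simp add: group_hom_def group_hom_axioms_def group_bar_chain_group)
  show ?thesis
    using assms(3)
  proof (induction rule: bar_chains_induct)
    case zero
    show ?case
      using B.hom_one subgroup.one_closed [OF subgroup_R]
      by (intro bexI [of _ \<one>]) (auto simp: \<theta>_0 rel_chain_one)
  next
    case (diff a b)
    let ?E = "frag_extend (\<lambda>gs. chain (lift (hd gs)))"
    from diff obtain r s where
      r: "r \<in> R" "\<theta> a = q r" "ab r = B (bar_boundary G a)"
         "homologous G (rel_chain r) (a + ?E (bar_boundary G a))" and
      s: "s \<in> R" "\<theta> b = q s" "ab s = B (bar_boundary G b)"
         "homologous G (rel_chain s) (b + ?E (bar_boundary G b))"
      by blast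
    have "inv s \<in> R" "r \<otimes> inv s \<in> R"
      using r s subgroup_R by (auto simp: subgroup.m_inv_closed subgroup.m_closed)
    have "homologous G (rel_chain (r \<otimes> inv s)) (rel_chain r + rel_chain (inv s))"
      using r \<open>inv s \<in> R\<close> by (intro rel_chain_mult)
    also have "homologous G \<dots> (rel_chain r + - rel_chain s)"
      using s by (intro homologous_add homologous_refl rel_chain_inv)
    also have "\<dots> = rel_chain r - rel_chain s"
      by simp
    also have "homologous G \<dots> ((a + ?E (bar_boundary G a)) - (b + ?E (bar_boundary G b)))"
      using r s by (intro homologous_diff)
    also have "\<dots> = (a - b) + ?E (bar_boundary G (a - b))"
      by (simp add: bar_boundary_diff frag_extend_diff)
    finally have "homologous G (rel_chain (r \<otimes> inv s)) ((a - b) + ?E (bar_boundary G (a - b)))" .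
    moreover have "\<theta> (a - b) = q (r \<otimes> inv s)"
      using diff r s by (simp add: \<theta>_diff R_carrier)
    moreover have "ab (r \<otimes> inv s) = B (bar_boundary G (a - b))"
    proof -
      have d: "bar_boundary G a \<in> bar_chains G 1" "bar_boundary G b \<in> bar_chains G 1"
        using diff p.H.bar_boundary_2_carrier by blast+
      have "ab (r \<otimes> inv s) = B (bar_boundary G a) \<otimes>\<^bsub>A\<^esub> inv\<^bsub>A\<^esub> B (bar_boundary G b)"
        using r s by (simp add: R_carrier)
      also have "\<dots> = B (bar_boundary G a \<otimes>\<^bsub>bar_chain_group G 1\<^esub> inv\<^bsub>bar_chain_group G 1\<^esub> bar_boundary G b)"
        using d B.hom_mult B.hom_inv B.G.inv_closed by (simp del: mult_bar_chain_group)
      finally show ?thesis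
        using d by (simp add: inv_bar_chain_group bar_boundary_diff)
    qed
    ultimately show ?case
      using \<open>r \<otimes> inv s \<in> R\<close> by blast
  next
    case (of gs)
    then obtain x y where gs: "gs = [x, y]" and xy: "x \<in> carrier G" "y \<in> carrier G"
      by (auto simp: length_Suc_conv numeral_2_eq_2)
    let ?E = "frag_extend (\<lambda>gs. chain (lift (hd gs)))" and ?r = "factor_set x y"
    let ?xy = "x \<otimes>\<^bsub>G\<^esub> y"
    have r: "?r \<in> R"
      using xy by (rule factor_set_R)
    \<comment> \<open>On [x|y] the relator is the factor set, and \<open>chain\<close> is computed
      in two ways on lift x lift y = r lift(xy).\<close>
    have "homologous G (chain (lift x \<otimes> lift y)) (rel_chain ?r + chain (lift ?xy))"
      using chain_mult_R [OF r, of "lift ?xy"] xy by (simp add: lift factor_set_mult)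
    moreover have "homologous G (chain (lift x \<otimes> lift y)) (chain (lift x) + chain (lift y) + frag_of [x, y])"
      using chain_mult [of "lift x" "lift y"] xy by (simp add: lift)
    ultimately have "homologous G (rel_chain ?r + chain (lift ?xy)) (chain (lift x) + chain (lift y) + frag_of [x, y])"
      by (rule homologous_trans [OF homologous_sym])
    from homologous_diff [OF this homologous_refl [of G "chain (lift ?xy)"]]
    have "homologous G (rel_chain ?r) (frag_of gs + ?E (bar_boundary G (frag_of gs)))"
      by (simp add: gs bar_boundary_def bar_boundary_gen_2 frag_extend_add frag_extend_diff algebra_simps)
    moreover have "ab ?r = B (bar_boundary G (frag_of gs))"
    proof -
      interpret A: comm_group A
        by (rule comm_A)
      let ?c = "\<lambda>x. frag_of [x]"
      have c: "?c x \<in> bar_chains G 1" "?c y \<in> bar_chains G 1" "?c ?xy \<in> bar_chains G 1"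
        using xy by (auto simp: bar_chains_of)
      have "B (bar_boundary G (frag_of gs)) = B (?c y \<otimes>\<^bsub>bar_chain_group G 1\<^esub>
          inv\<^bsub>bar_chain_group G 1\<^esub> ?c ?xy \<otimes>\<^bsub>bar_chain_group G 1\<^esub> ?c x)"
        using c by (simp add: inv_bar_chain_group gs bar_boundary_def bar_boundary_gen_2)
      also have "\<dots> = ab (lift y) \<otimes>\<^bsub>A\<^esub> inv\<^bsub>A\<^esub> ab (lift ?xy) \<otimes>\<^bsub>A\<^esub> ab (lift x)"
        using c xy B.hom_mult B.hom_inv B.G.inv_closed B.G.m_closed B(2) by (simp del: mult_bar_chain_group)
      also have "\<dots> = ab ?r"
        using xy by (simp add: factor_set_def lift A.m_ac)
      finally show ?thesis ..
    qed
    ultimately show ?case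
      using r xy gs \<theta>_of by auto
  qed
qed

text \<open>The isomorphism is induced by \<open>\<theta>\<close>: \<open>\<theta>_rel_chain\<close>
  gives surjectivity on cycles, and the kernel consists of the boundaries because the relator of a
  cycle determines it up to homology.\<close>

theorem hopf_formula:
  "integral_homology 2 G \<cong> Q\<lparr>carrier := q ` (R \<inter> D)\<rparr>"
proof -
  interpret A: comm_group A
    by (rule comm_A)
  let ?T = "{gs. length gs = 1 \<and> set gs \<subseteq> carrier G}"
  let ?Z = "bar_chain_group G 2\<lparr>carrier := bar_cycles G 2\<rparr>" and ?H = "Q\<lparr>carrier := q ` (R \<inter> D)\<rparr>"
  have "(\<lambda>gs. ab (lift (hd gs))) ` ?T \<subseteq> carrier A"
    by (auto simp: length_Suc_conv lift)
  from A.free_Abelian_group_universal [OF this]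
  obtain B where B: "B \<in> hom (bar_chain_group G 1) A"
    and B_of: "\<And>gs. gs \<in> ?T \<Longrightarrow> B (frag_of gs) = ab (lift (hd gs))"
    unfolding bar_chain_group_def by blast
  have "B (frag_of [x]) = ab (lift x)" if "x \<in> carrier G" for x
    using that B_of [of "[x]"] by simp
  note rel = chain_relator [OF B this]
  have "B 0 = \<one>\<^bsub>A\<^esub>"
    using hom_one [OF B group_bar_chain_group ab.H.is_group] by simp
  \<comment> \<open>For a cycle both corrections in \<open>chain_relator\<close> vanish, and
    \<open>ab r = B 0\<close> puts r into [F,F].\<close>
  have cycle: "\<exists>r\<in>R \<inter> D. \<theta> c = q r \<and> homologous G (rel_chain r) c" if "c \<in> bar_cycles G 2" for c
  proof -
    have "c \<in> bar_chains G 2" "bar_boundary G c = 0"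
      using that by (auto simp: bar_cycles_def)
    then obtain r where "r \<in> R" "\<theta> c = q r" "ab r = B 0" "homologous G (rel_chain r) c"
      using rel by fastforce
    then show ?thesis
      using \<open>B 0 = \<one>\<^bsub>A\<^esub>\<close> by (auto simp: kernel_def)
  qed
  have Z: "group ?Z"
    by (rule group.subgroup_imp_group [OF group_bar_chain_group p.H.subgroup_bar_cycles])
  have "subgroup (q ` (R \<inter> D)) Q"
    by (intro q.subgroup_img_is_subgroup p.G.subgroups_Inter_pair p.subgroup_kernel ab.subgroup_kernel)
  then have H: "group ?H"
    by (rule q.H.subgroup_imp_group)
  have chains: "c \<in> bar_chains G 2" if "c \<in> bar_cycles G 2" for c
    using that by (simp add: bar_cycles_def)
  have "\<theta> \<in> hom ?Z ?H"
    using cycle by (intro homI) (auto simp: \<theta>_add chains)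
  then interpret \<theta>: group_hom ?Z ?H \<theta>
    using Z H by (simp add: group_hom_def group_hom_axioms_def)
  have "\<theta> ` carrier ?Z = carrier ?H"
  proof
    show "carrier ?H \<subseteq> \<theta> ` carrier ?Z"
    proof
      fix z assume "z \<in> carrier ?H"
      then obtain r where r: "r \<in> R" "r \<in> D" "z = q r"
        by auto
      then show "z \<in> \<theta> ` carrier ?Z"
        by (intro image_eqI [of _ _ "rel_chain r"]) (auto simp: \<theta>_rel_chain rel_chain_cycle)
    qed
  qed (use cycle in auto)
  moreover have "kernel ?Z ?H \<theta> = bar_boundaries G 2"
  proof
    show "bar_boundaries G 2 \<subseteq> kernel ?Z ?H \<theta>"
      using p.H.bar_boundaries_2_subset by (auto simp: kernel_def \<theta>_boundary)
    show "kernel ?Z ?H \<theta> \<subseteq> bar_boundaries G 2"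
    proof
      fix c assume "c \<in> kernel ?Z ?H \<theta>"
      then have c: "c \<in> bar_cycles G 2" "\<theta> c = \<one>\<^bsub>Q\<^esub>"
        by (auto simp: kernel_def)
      then obtain r where r: "r \<in> R" "q r = \<one>\<^bsub>Q\<^esub>" "homologous G (rel_chain r) c"
        using cycle by fastforce
      \<comment> \<open>A cycle with trivial value has its relator r in [F,R], where
        \<open>rel_chain\<close> is a boundary; but \<open>rel_chain r\<close> is homologous to c
        itself.\<close>
      then have "homologous G (rel_chain r) 0"
        by (intro rel_chain_kernel_q) (simp add: kernel_def)
      then have "homologous G c 0"
        using r homologous_sym homologous_trans by blast
      then show "c \<in> bar_boundaries G 2"
        by (simp add: homologous_def)
    qed
  qed
  ultimately show ?thesis
    using \<theta>.FactGroup_iso by (simp add: integral_homology_def)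
qed

end

section \<open>Hopf's formula for a presentation by a free group\<close>

lemma (in normal) kernel_r_coset: "kernel G (G Mod H) (\<lambda>a. H #> a) = H"
  using r_coset_eq_one_iff subset by (auto simp: kernel_def)

text \<open>The instance Q = F/[F,R], A = F/[F,F], with \<open>word_chain\<close> as
  \<open>chain\<close>. \<open>hopf_group\<close> is a quotient of a subgroup of F, while
  \<open>hopf_formula\<close> yields a subgroup of F/[F,R]; \<open>FactGroup_carrier_update\<close>
  identifies the two.\<close>

theorem free_group_hopf_formula:
  assumes "R \<lhd> free_group S"
  shows "integral_homology 2 (free_group S Mod R) \<cong> hopf_group (free_group S) R"
proof -
  let ?F = "free_group S"
  interpret F: group ?F
    by (rule group_free_group)
  let ?K = "commutator_subgroup ?F (carrier ?F) R" and ?D = "commutator_subgroup ?F (carrier ?F) (carrier ?F)"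
  interpret R: normal R ?F
    by fact
  interpret K: normal ?K ?F
    by (rule F.normal_commutator_subgroup [OF F.normal_self assms])
  interpret D: normal ?D ?F
    by (rule F.normal_commutator_subgroup [OF F.normal_self F.normal_self])
  interpret w: free_group_hom S "?F Mod R" "\<lambda>a. R #>\<^bsub>?F\<^esub> a"
    by (rule free_group_hom.intro [OF R.group_hom_r_coset])
  interpret hopf_data ?F "?F Mod R" "\<lambda>a. R #>\<^bsub>?F\<^esub> a" "?F Mod ?K" "\<lambda>a. ?K #>\<^bsub>?F\<^esub> a"
    "?F Mod ?D" "\<lambda>a. ?D #>\<^bsub>?F\<^esub> a" w.word_chain
  proof (intro hopf_data.intro hopf_data_axioms.intro R.group_hom_r_coset K.group_hom_r_coset D.group_hom_r_coset)
    show "comm_group (?F Mod ?D)"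
      using F.derived_quot_is_comm_group by (simp add: F.commutator_subgroup_carrier)
  qed (simp_all add: R.kernel_r_coset K.kernel_r_coset D.kernel_r_coset carrier_FactGroup w.word_chain_carrier
      w.word_chain_mult del: mult_FactGroup)
  have "R \<inter> ?D \<subseteq> carrier ?F"
    using R.subset by blast
  then have "hopf_group ?F R = (?F Mod ?K)\<lparr>carrier := (\<lambda>a. ?K #>\<^bsub>?F\<^esub> a) ` (R \<inter> ?D)\<rparr>"
    unfolding hopf_group_def by (rule FactGroup_carrier_update)
  then show ?thesis
    using hopf_formula by (simp add: R.kernel_r_coset D.kernel_r_coset)
qed

section \<open>Elementary abelian 2-groups\<close>

context comm_group
begin

lemma bit_scale_closed: "x \<in> carrier G \<Longrightarrow> bit_scale G a x \<in> carrier G"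
  by (simp add: bit_scale_def)

lemma bit_lincomb_closed: "T \<subseteq> carrier G \<Longrightarrow> bit_lincomb G T c \<in> carrier G"
  unfolding bit_lincomb_def by (rule finprod_closed) (auto intro: bit_scale_closed)

lemma bit_scale_add:
  assumes "x \<in> carrier G" "x \<otimes> x = \<one>"
  shows "bit_scale G (a + b) x = bit_scale G a x \<otimes> bit_scale G b x"
  using assms by (cases a; cases b) (auto simp: bit_scale_def)

text \<open>Padding with zero coefficients brings two combinations to a common support, where their
  coefficients can be added.\<close>

lemma bit_lincomb_extend:
  assumes "finite T'" "T \<subseteq> T'" "T' \<subseteq> carrier G"
  shows "bit_lincomb G T c = bit_lincomb G T' (\<lambda>x. if x \<in> T then c x else 0)"
  unfolding bit_lincomb_def
  by (rule finprod_mono_neutral_cong_left) (use assms in \<open>auto simp: bit_scale_def\<close>)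

lemma bit_span_mult:
  assumes el: "elementary_abelian_2_group G" and B: "B \<subseteq> carrier G"
    and "x \<in> bit_span G B" "y \<in> bit_span G B"
  shows "x \<otimes> y \<in> bit_span G B"
proof -
  from assms obtain T c U d where
    T: "finite T" "T \<subseteq> B" "x = bit_lincomb G T c" and U: "finite U" "U \<subseteq> B" "y = bit_lincomb G U d"
    by (auto simp: bit_span_def)
  let ?c = "\<lambda>x. if x \<in> T then c x else 0" and ?d = "\<lambda>x. if x \<in> U then d x else 0"
  have TU: "T \<union> U \<subseteq> carrier G"
    using T U B by blast
  have "x \<otimes> y = bit_lincomb G (T \<union> U) ?c \<otimes> bit_lincomb G (T \<union> U) ?d"
    using T U TU bit_lincomb_extend [of "T \<union> U" T c] bit_lincomb_extend [of "T \<union> U" U d] by simp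
  also have "\<dots> = finprod G (\<lambda>x. bit_scale G (?c x) x \<otimes> bit_scale G (?d x) x) (T \<union> U)"
    unfolding bit_lincomb_def
    by (rule finprod_multf [symmetric]) (use TU in \<open>auto intro!: bit_scale_closed\<close>)
  also have "\<dots> = bit_lincomb G (T \<union> U) (\<lambda>x. ?c x + ?d x)"
    unfolding bit_lincomb_def
  proof (rule finprod_cong')
    fix x assume "x \<in> T \<union> U"
    then show "bit_scale G (?c x) x \<otimes> bit_scale G (?d x) x = bit_scale G (?c x + ?d x) x"
      using TU el by (intro bit_scale_add [symmetric]) (auto simp: elementary_abelian_2_group_def)
  qed (use TU in \<open>auto intro: bit_scale_closed\<close>)
  finally show ?thesis
    using T U unfolding bit_span_def by blast
qed

text \<open>Every element is its own inverse, so closure of the span under products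
  suffices.\<close>

lemma generate_subset_bit_span:
  assumes el: "elementary_abelian_2_group G" and B: "B \<subseteq> carrier G"
  shows "generate G B \<subseteq> bit_span G B"
proof
  fix x assume "x \<in> generate G B"
  then show "x \<in> bit_span G B"
  proof (induction rule: generate.induct)
    case one
    have "\<one> = bit_lincomb G {} (\<lambda>_. 0)"
      by (simp add: bit_lincomb_def)
    then show ?case
      unfolding bit_span_def by blast
  next
    case (incl x)
    have "x = bit_lincomb G {x} (\<lambda>_. 1)"
      using incl B by (auto simp: bit_lincomb_def bit_scale_def)
    then show ?case
      using incl unfolding bit_span_def by blast
  next
    case (inv x)
    have "inv x = x"
      using inv B el by (intro inv_equality) (auto simp: elementary_abelian_2_group_def)
    moreover have "x = bit_lincomb G {x} (\<lambda>_. 1)"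
      using inv B by (auto simp: bit_lincomb_def bit_scale_def)
    ultimately show ?case
      using inv unfolding bit_span_def by fastforce
  next
    case (eng x y)
    then show ?case
      using bit_span_mult [OF el B] by blast
  qed
qed

end


section \<open>Two elements with central squares\<close>

text \<open>Applied to the images of two generators in F/[F,R].\<close>

locale central_squares = group +
  fixes x y
  assumes x [simp]: "x \<in> carrier G" and y [simp]: "y \<in> carrier G"
    and xx: "x \<otimes> x \<otimes> y = y \<otimes> (x \<otimes> x)" and yy: "y \<otimes> y \<otimes> x = x \<otimes> (y \<otimes> y)"
begin

text \<open>x y^2 x and y x^2 y both equal x^2 y^2.\<close>

lemma products_commute: "(x \<otimes> y) \<otimes> (y \<otimes> x) = (y \<otimes> x) \<otimes> (x \<otimes> y)"
proof -
  have "(x \<otimes> y) \<otimes> (y \<otimes> x) = x \<otimes> (y \<otimes> y \<otimes> x)"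
    by (simp add: m_assoc)
  also have "\<dots> = x \<otimes> x \<otimes> y \<otimes> y"
    by (simp add: yy) (simp add: m_assoc)
  also have "\<dots> = (y \<otimes> x) \<otimes> (x \<otimes> y)"
    by (simp add: xx) (simp add: m_assoc)
  finally show ?thesis .
qed

lemma commutator_eq: "group_commutator G x y = (x \<otimes> y) \<otimes> inv (y \<otimes> x)"
  by (simp add: group_commutator_def inv_mult_group m_assoc)

text \<open>[x,y] is the product of the commuting elements xy and (yx)^-1, so the power distributes.
  This turns the relator of a pair into a power of a commutator.\<close>

lemma commutator_pow:
  "group_commutator G x y [^] (k::nat) = (x \<otimes> y) [^] k \<otimes> inv ((y \<otimes> x) [^] k)"
proof -
  have "(x \<otimes> y) \<otimes> inv (y \<otimes> x) = inv (y \<otimes> x) \<otimes> (x \<otimes> y)"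
    using products_commute by (metis inv_solve_left inv_solve_right m_assoc m_closed inv_closed x y)
  then show ?thesis
    unfolding commutator_eq by (subst pow_mult_distrib) (simp_all add: nat_pow_inv)
qed

text \<open>Conjugation by \<open>x\<close> exchanges \<open>x y\<close> and \<open>y x\<close>, hence inverts the central element
  \<open>(x y)^k (y x)^-k\<close>.\<close>

lemma commutator_pow_square:
  assumes c: "group_commutator G x y [^] (k::nat) \<otimes> x = x \<otimes> group_commutator G x y [^] k"
  shows "group_commutator G x y [^] k \<otimes> group_commutator G x y [^] k = \<one>"
proof -
  define a b where "a = (x \<otimes> y) [^] k" and "b = (y \<otimes> x) [^] k"
  have ab [simp]: "a \<in> carrier G" "b \<in> carrier G"
    by (auto simp: a_def b_def)
  have ax: "a \<otimes> x = x \<otimes> b"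
    unfolding a_def b_def
  proof (induction k)
    case (Suc k)
    have "(x \<otimes> y) [^] Suc k \<otimes> x = ((x \<otimes> y) [^] k \<otimes> x) \<otimes> (y \<otimes> x)"
      by (simp add: m_assoc)
    then show ?case
      by (simp add: Suc) (simp add: m_assoc)
  qed simp
  \<comment> \<open>Unlike \<open>ax\<close>, which is pure regrouping, this direction needs x^2 to
    commute with y.\<close>
  have xa: "x \<otimes> a = b \<otimes> x"
    unfolding a_def b_def
  proof (induction k)
    case (Suc k)
    have "x \<otimes> (x \<otimes> y) [^] Suc k = ((y \<otimes> x) [^] k \<otimes> x) \<otimes> (x \<otimes> y)"
      by (simp add: Suc flip: m_assoc)
    also have "\<dots> = (y \<otimes> x) [^] k \<otimes> (x \<otimes> x \<otimes> y)"
      by (simp add: m_assoc)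
    also have "\<dots> = (y \<otimes> x) [^] Suc k \<otimes> x"
      by (simp add: xx) (simp add: m_assoc)
    finally show ?case .
  qed simp
  define r where "r = a \<otimes> inv b"
  have r: "r \<in> carrier G" "group_commutator G x y [^] k = r"
    by (auto simp: r_def commutator_pow a_def b_def)
  have "inv b \<otimes> x = x \<otimes> inv a"
    using xa by (metis ab x inv_closed inv_solve_left inv_solve_right m_assoc m_closed)
  then have "r \<otimes> x = a \<otimes> x \<otimes> inv a"
    by (simp add: r_def m_assoc)
  also have "\<dots> = x \<otimes> (b \<otimes> inv a)"
    by (simp add: ax) (simp add: m_assoc)
  also have "b \<otimes> inv a = inv r"
    by (simp add: r_def inv_mult_group)
  \<comment> \<open>Conjugation by x inverts r, while the assumption \<open>c\<close> says that it
    fixes r.\<close>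
  finally have "x \<otimes> r = x \<otimes> inv r"
    using c r by simp
  then have "r = inv r"
    using r by simp
  then have "r \<otimes> r = \<one>"
    using r by (metis r_inv)
  then show ?thesis
    using r by simp
qed

end


section \<open>The infinite dihedral group\<close>

text \<open>\<open>(a, e)\<close> is the map z -> a + z of the integers, or z -> a - z if
  \<open>e\<close> holds, and the product is composition. The translations \<open>(a, False)\<close>
  are the rotations of the infinite dihedral group.\<close>

definition dihedral :: "(int \<times> bool) monoid" where
  "dihedral = \<lparr>carrier = UNIV,
     monoid.mult = (\<lambda>(a, e) (b, f). (a + (if e then - b else b), e \<noteq> f)),
     one = (0, False)\<rparr>"

lemma carrier_dihedral [simp]: "carrier dihedral = UNIV"
  by (simp add: dihedral_def)

lemma mult_dihedral [simp]:
  "(a, e) \<otimes>\<^bsub>dihedral\<^esub> (b, f) = (a + (if e then - b else b), e \<noteq> f)"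
  by (simp add: dihedral_def)

lemma one_dihedral: "\<one>\<^bsub>dihedral\<^esub> = (0, False)"
  by (simp add: dihedral_def)

lemma group_dihedral: "group dihedral"
proof (rule groupI)
  fix x assume "x \<in> carrier dihedral"
  obtain a e where "x = (a, e)"
    by fastforce
  then show "\<exists>y\<in>carrier dihedral. y \<otimes>\<^bsub>dihedral\<^esub> x = \<one>\<^bsub>dihedral\<^esub>"
    by (intro bexI [of _ "(if e then a else - a, e)"]) (auto simp: one_dihedral)
qed (auto simp: one_dihedral)

lemma inv_dihedral [simp]: "inv\<^bsub>dihedral\<^esub> (a, e) = (if e then a else - a, e)"
  by (rule group.inv_equality [OF group_dihedral]) (auto simp: one_dihedral)

lemma pow_dihedral [simp]: "(a, False) [^]\<^bsub>dihedral\<^esub> (k::nat) = (int k * a, False)"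
  by (induction k) (auto simp: nat_pow_def one_dihedral algebra_simps)

section \<open>Even Coxeter groups\<close>

locale even_coxeter =
  fixes n :: nat and m :: "nat \<Rightarrow> nat \<Rightarrow> enat"
  assumes even: "even_coxeter_matrix n m"
begin

definition F where "F = coxeter_free n"

definition R where "R = even_coxeter_kernel n m"

definition D where "D = commutator_subgroup F (carrier F) (carrier F)"

definition K where "K = commutator_subgroup F (carrier F) R"

definition Q where "Q = F Mod K"

definition q where "q a = K #>\<^bsub>F\<^esub> a"

definition sq where "sq i = free_gen i [^]\<^bsub>F\<^esub> (2::nat)"

definition braid where
  "braid i j = ((free_gen i \<otimes>\<^bsub>F\<^esub> free_gen j) [^]\<^bsub>F\<^esub> half_exp m i j)
     \<otimes>\<^bsub>F\<^esub> inv\<^bsub>F\<^esub> ((free_gen j \<otimes>\<^bsub>F\<^esub> free_gen i) [^]\<^bsub>F\<^esub> half_exp m i j)"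

definition comm_pow where
  "comm_pow i j = group_commutator F (free_gen i) (free_gen j) [^]\<^bsub>F\<^esub> half_exp m i j"

lemma F_eq: "F = free_group {1..n}"
  by (simp add: F_def coxeter_free_def)

sublocale F: group F
  by (simp add: F_eq group_free_group)

lemma gen_carrier: "i \<in> {1..n} \<Longrightarrow> free_gen i \<in> carrier F"
  by (simp add: F_eq free_gen_carrier del: atLeastAtMost_iff)

lemma finite_pairs_bounds:
  assumes "(i, j) \<in> finite_pairs n m"
  shows "i \<in> {1..n}" "j \<in> {1..n}" "i < j"
  using assms by (auto simp: finite_pairs_def)

lemma finite_pairs_gens:
  assumes "(i, j) \<in> finite_pairs n m"
  shows "free_gen i \<in> carrier F" "free_gen j \<in> carrier F"
  using finite_pairs_bounds [OF assms] gen_carrier by blast+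

text \<open>Needed for independence: odd and even multiples of 2 n(k,l) are distinct only if n(k,l)
  is nonzero.\<close>

lemma half_exp_pos:
  assumes "(i, j) \<in> finite_pairs n m"
  shows "half_exp m i j > 0"
proof -
  have ij: "i \<in> {1..n}" "j \<in> {1..n}" "i \<noteq> j" "half_entry m i j < \<infinity>"
    using assms by (auto simp: finite_pairs_def)
  then have "m i j \<noteq> \<infinity>"
    by (cases "m i j") (auto simp: half_entry_def)
  moreover have "m i j = \<infinity> \<or> (\<exists>k. m i j = enat k \<and> 2 dvd k \<and> 0 < k)"
    using conjunct2 [OF even [unfolded even_coxeter_matrix_def]] ij(1-3) by simp
  ultimately obtain k where "m i j = enat k" "2 dvd k" "0 < k"
    by auto
  moreover from this have "k div 2 > 0"
    by presburger
  ultimately show ?thesis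
    by (simp add: half_exp_def half_entry_def)
qed

lemma relators: "even_coxeter_relators n m =
    sq ` {1..n} \<union> (\<lambda>(i, j). braid i j) ` finite_pairs n m"
  by (auto simp: even_coxeter_relators_def Let_def sq_def braid_def F_def)

lemma sq_carrier: "i \<in> {1..n} \<Longrightarrow> sq i \<in> carrier F"
  by (simp add: sq_def gen_carrier del: atLeastAtMost_iff)

lemma braid_carrier: "(i, j) \<in> finite_pairs n m \<Longrightarrow> braid i j \<in> carrier F"
  using finite_pairs_gens [of i j] by (simp add: braid_def)

lemma comm_pow_carrier: "(i, j) \<in> finite_pairs n m \<Longrightarrow> comm_pow i j \<in> carrier F"
  using finite_pairs_gens [of i j] by (simp add: comm_pow_def F.group_commutator_closed)

lemma relators_carrier: "even_coxeter_relators n m \<subseteq> carrier F"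
  unfolding relators using sq_carrier braid_carrier by auto

lemma R_normal: "R \<lhd> F"
  using F.normal_closure_normal(1) [OF relators_carrier] by (simp add: R_def even_coxeter_kernel_def F_def)

lemma relators_R: "even_coxeter_relators n m \<subseteq> R"
  using F.normal_closure_normal(2) [OF relators_carrier] by (simp add: R_def even_coxeter_kernel_def F_def)

lemma R_minimal: "N \<lhd> F \<Longrightarrow> even_coxeter_relators n m \<subseteq> N \<Longrightarrow> R \<subseteq> N"
  using F.normal_closure_minimal by (simp add: R_def even_coxeter_kernel_def F_def)

sublocale R: normal R F
  by (rule R_normal)

sublocale K: normal K F
  unfolding K_def by (rule F.normal_commutator_subgroup [OF F.normal_self R_normal])

sublocale q: group_hom F Q q
  using K.group_hom_r_coset unfolding Q_def q_def [abs_def] .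

lemma q_eq_one_iff: "a \<in> carrier F \<Longrightarrow> q a = \<one>\<^bsub>Q\<^esub> \<longleftrightarrow> a \<in> K"
  using K.r_coset_eq_one_iff by (simp add: q_def Q_def)

lemma q_eq_iff: "a \<in> carrier F \<Longrightarrow> b \<in> carrier F \<Longrightarrow> q a = q b \<longleftrightarrow> a \<otimes>\<^bsub>F\<^esub> inv\<^bsub>F\<^esub> b \<in> K"
  using K.r_coset_eq_iff by (simp add: q_def)

lemma K_subset_R: "K \<subseteq> R"
  unfolding K_def by (rule F.commutator_subgroup_subset_right [OF R_normal]) simp

lemma q_central:
  assumes "r \<in> R" "f \<in> carrier F"
  shows "q r \<otimes>\<^bsub>Q\<^esub> q f = q f \<otimes>\<^bsub>Q\<^esub> q r"
proof -
  have c: "r \<in> carrier F" "group_commutator F f r \<in> carrier F"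
    using assms R.mem_carrier F.group_commutator_closed by auto
  have "group_commutator F f r \<in> K"
    unfolding K_def using assms by (intro F.group_commutator_in_subgroup)
  then have "group_commutator F f r \<in> kernel F Q q"
    using c q_eq_one_iff by (simp add: kernel_def)
  then show ?thesis
    by (rule q.commute_if_commutator_kernel) (fact assms c)+
qed

lemma subgroup_D: "subgroup D F"
  unfolding D_def
  by (rule normal_imp_subgroup) (rule F.normal_commutator_subgroup [OF F.normal_self F.normal_self])

lemma comm_pow_D:
  assumes "(i, j) \<in> finite_pairs n m"
  shows "comm_pow i j \<in> D"
proof -
  interpret D: subgroup D F
    by (rule subgroup_D)
  have "group_commutator F (free_gen i) (free_gen j) \<in> D"
    unfolding D_def using finite_pairs_gens [OF assms] by (intro F.group_commutator_in_subgroup)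
  then have "group_commutator F (free_gen i) (free_gen j) [^]\<^bsub>F\<^esub> (k::nat) \<in> D" for k
    by (induction k) auto
  then show ?thesis
    by (simp add: comm_pow_def)
qed

lemma q_squares:
  assumes "i \<in> {1..n}" "f \<in> carrier F"
  shows "q (free_gen i) \<otimes>\<^bsub>Q\<^esub> q (free_gen i) \<otimes>\<^bsub>Q\<^esub> q f = q f \<otimes>\<^bsub>Q\<^esub> (q (free_gen i) \<otimes>\<^bsub>Q\<^esub> q (free_gen i))"
proof -
  have "sq i \<in> R"
    using relators_R relators assms by auto
  moreover have "sq i = free_gen i \<otimes>\<^bsub>F\<^esub> free_gen i"
    using gen_carrier [OF assms(1)] by (simp add: sq_def numeral_2_eq_2)
  ultimately show ?thesis
    using q_central [of "sq i" f] assms gen_carrier by simp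
qed

lemma central_squares_q:
  assumes "(i, j) \<in> finite_pairs n m"
  shows "central_squares Q (q (free_gen i)) (q (free_gen j))"
  using q_squares finite_pairs_bounds [OF assms] finite_pairs_gens [OF assms]
  by unfold_locales (simp_all del: atLeastAtMost_iff)

lemma q_comm_pow:
  assumes ij: "(i, j) \<in> finite_pairs n m"
  shows "q (comm_pow i j) = q (braid i j)"
proof -
  interpret central_squares Q "q (free_gen i)" "q (free_gen j)"
    by (rule central_squares_q [OF ij])
  have c: "free_gen i \<in> carrier F" "free_gen j \<in> carrier F"
    using finite_pairs_gens [OF ij] by auto
  show ?thesis
    using commutator_pow [of "half_exp m i j"] c
    by (simp add: comm_pow_def braid_def q.hom_nat_pow q.hom_group_commutator F.group_commutator_closed)
qed

lemma braid_R: "(i, j) \<in> finite_pairs n m \<Longrightarrow> braid i j \<in> R"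
  using relators_R relators by auto

text \<open>The power of the commutator differs from the relator of the pair by an element of [F,R],
  which lies in R.\<close>

lemma comm_pow_R:
  assumes ij: "(i, j) \<in> finite_pairs n m"
  shows "comm_pow i j \<in> R"
proof -
  have c: "comm_pow i j \<in> carrier F" "braid i j \<in> carrier F"
    using ij comm_pow_carrier braid_carrier by auto
  then have "comm_pow i j \<otimes>\<^bsub>F\<^esub> inv\<^bsub>F\<^esub> braid i j \<in> R"
    using q_comm_pow [OF ij] q_eq_iff K_subset_R by blast
  then have "comm_pow i j \<otimes>\<^bsub>F\<^esub> inv\<^bsub>F\<^esub> braid i j \<otimes>\<^bsub>F\<^esub> braid i j \<in> R"
    using braid_R [OF ij] by (rule R.m_closed)
  then show ?thesis
    using c by (simp add: F.m_assoc)
qed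

text \<open>As an element of R, the power of the commutator is central in Q; in particular it
  commutes with the first generator, as \<open>commutator_pow_square\<close> requires.\<close>

lemma q_comm_pow_square:
  assumes ij: "(i, j) \<in> finite_pairs n m"
  shows "q (comm_pow i j) \<otimes>\<^bsub>Q\<^esub> q (comm_pow i j) = \<one>\<^bsub>Q\<^esub>"
proof -
  interpret central_squares Q "q (free_gen i)" "q (free_gen j)"
    by (rule central_squares_q [OF ij])
  have c: "free_gen i \<in> carrier F" "free_gen j \<in> carrier F"
    using finite_pairs_gens [OF ij] by auto
  have "q (comm_pow i j) = group_commutator Q (q (free_gen i)) (q (free_gen j)) [^]\<^bsub>Q\<^esub> half_exp m i j"
    using c by (simp add: comm_pow_def q.hom_nat_pow q.hom_group_commutator F.group_commutator_closed)
  then show ?thesis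
    using commutator_pow_square q_central [OF comm_pow_R [OF ij] c(1)] by simp
qed

subsection \<open>The classes span\<close>

text \<open>The squares of the generators lie in R but not in [F,F], so the spanning argument has to
  take place in this larger group, which contains \<open>Hopf\<close>.\<close>

definition QR where "QR = Q\<lparr>carrier := q ` R\<rparr>"

definition Hopf where "Hopf = Q\<lparr>carrier := q ` (R \<inter> D)\<rparr>"

definition comm_classes where "comm_classes = (\<lambda>(i, j). q (comm_pow i j)) ` finite_pairs n m"

lemma hopf_group_eq: "hopf_group F R = Hopf"
proof -
  have "R \<inter> D \<subseteq> carrier F"
    using R.subset by blast
  from FactGroup_carrier_update [OF this, of K] show ?thesis
    by (simp add: hopf_group_def Hopf_def Q_def q_def [abs_def] D_def K_def)
qed

lemma commutator_power_class_eq: "commutator_power_class n m = (\<lambda>(i, j). q (comm_pow i j))"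
  by (simp add: commutator_power_class_def q_def K_def comm_pow_def F_def R_def Let_def)

lemma comm_group_QR: "comm_group QR"
proof -
  have "group QR"
    unfolding QR_def
    by (intro q.H.subgroup_imp_group q.subgroup_img_is_subgroup normal_imp_subgroup R_normal)
  moreover have "q r \<otimes>\<^bsub>Q\<^esub> q s = q s \<otimes>\<^bsub>Q\<^esub> q r" if "r \<in> R" "s \<in> R" for r s
    using that by (intro q_central R.mem_carrier)
  ultimately show ?thesis
    by (intro group.group_comm_groupI) (auto simp: QR_def)
qed

lemma comm_group_Hopf: "comm_group Hopf"
proof -
  have "group Hopf"
    unfolding Hopf_def
    by (intro q.H.subgroup_imp_group q.subgroup_img_is_subgroup F.subgroups_Inter_pair
        normal_imp_subgroup R_normal subgroup_D)
  moreover have "q r \<otimes>\<^bsub>Q\<^esub> q s = q s \<otimes>\<^bsub>Q\<^esub> q r" if "r \<in> R" "s \<in> R" for r s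
    using that by (intro q_central R.mem_carrier)
  ultimately show ?thesis
    by (intro group.group_comm_groupI) (auto simp: Hopf_def)
qed

sublocale QR: comm_group QR
  by (rule comm_group_QR)

sublocale Hopf: comm_group Hopf
  by (rule comm_group_Hopf)

lemma QR_simps: "carrier QR = q ` R" "x \<otimes>\<^bsub>QR\<^esub> y = x \<otimes>\<^bsub>Q\<^esub> y" "\<one>\<^bsub>QR\<^esub> = \<one>\<^bsub>Q\<^esub>"
  by (simp_all add: QR_def)

lemma Hopf_simps: "carrier Hopf = q ` (R \<inter> D)" "x \<otimes>\<^bsub>Hopf\<^esub> y = x \<otimes>\<^bsub>Q\<^esub> y" "\<one>\<^bsub>Hopf\<^esub> = \<one>\<^bsub>Q\<^esub>"
  by (simp_all add: Hopf_def)

lemma comm_classes_carrier: "comm_classes \<subseteq> carrier Hopf"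
  using comm_pow_R comm_pow_D by (auto simp: comm_classes_def Hopf_simps)

section \<open>Exponent sums and the decomposition of relators\<close>

definition expo where "expo = free_lift (free_Abelian_group {1..n}) frag_of"

lemma expo_hom: "expo \<in> hom F (free_Abelian_group {1..n})"
  unfolding expo_def F_eq by (rule group.free_lift_hom) auto

lemma expo_gen: "i \<in> {1..n} \<Longrightarrow> expo (free_gen i) = frag_of i"
  unfolding expo_def by (rule group.free_lift_free_gen) auto

text \<open>Modulo \<open>K\<close> a relator is a product of squares \<open>sq i\<close> and of the given classes; its exponent sums are
  twice the multiplicities of the squares, so these vanish on \<open>D\<close>.\<close>

lemma R_decomposition:
  assumes g: "g \<in> hom (free_Abelian_group {1..n}) QR" "\<And>i. i \<in> {1..n} \<Longrightarrow> g (frag_of i) = q (sq i)"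
  assumes "r \<in> R"
  shows "\<exists>v C. Poly_Mapping.keys v \<subseteq> {1..n} \<and> C \<in> generate Hopf comm_classes \<and> q r = g v \<otimes>\<^bsub>Q\<^esub> C \<and> expo r = v + v"
proof -
  interpret FA: comm_group "free_Abelian_group {1..n}"
    by (rule abelian_free_Abelian_group)
  interpret e: group_hom F "free_Abelian_group {1..n}" expo
    using expo_hom by (simp add: group_hom_def group_hom_axioms_def F.is_group)
  interpret g: group_hom "free_Abelian_group {1..n}" QR g
    using g(1) by (simp add: group_hom_def group_hom_axioms_def QR.is_group)
  let ?P = "\<lambda>r v C. v \<in> carrier (free_Abelian_group {1..n}) \<and> C \<in> generate Hopf comm_classes \<and>
      q r = g v \<otimes>\<^bsub>QR\<^esub> C \<and> expo r = v \<otimes>\<^bsub>free_Abelian_group {1..n}\<^esub> v"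
  \<comment> \<open>R is a normal closure, so it suffices that the decomposable elements form a
    normal subgroup containing the relators.\<close>
  let ?N = "{r \<in> R. \<exists>v C. ?P r v C}"
  have gen: "C \<in> carrier Hopf" "C \<in> carrier QR" if "C \<in> generate Hopf comm_classes" for C
    using that Hopf.generate_in_carrier [OF comm_classes_carrier] by (auto simp: Hopf_simps QR_simps)
  note [simp del] = mult_free_Abelian_group carrier_free_Abelian_group_iff One_nat_def
  \<comment> \<open>\<open>C\<close> is inverted inside the generated subgroup of
    \<open>Hopf\<close>, but \<open>q r\<close> in \<open>QR\<close>; both inverses are that of
    Q.\<close>
  have inv_eq: "inv\<^bsub>Hopf\<^esub> C = inv\<^bsub>QR\<^esub> C" if "C \<in> generate Hopf comm_classes" for C
  proof -
    have i: "inv\<^bsub>Hopf\<^esub> C \<in> carrier Hopf"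
      using gen that by simp
    then have "inv\<^bsub>Hopf\<^esub> C \<in> carrier QR"
      by (auto simp: Hopf_simps QR_simps)
    moreover have "inv\<^bsub>Hopf\<^esub> C \<otimes>\<^bsub>QR\<^esub> C = \<one>\<^bsub>QR\<^esub>"
      using Hopf.l_inv [OF gen(1) [OF that]] by (simp add: Hopf_simps QR_simps)
    ultimately show ?thesis
      using QR.inv_equality gen(2) [OF that] by metis
  qed
  have q_mult: "q (r \<otimes>\<^bsub>F\<^esub> s) = q r \<otimes>\<^bsub>QR\<^esub> q s" if "r \<in> R" "s \<in> R" for r s
    using that R.subset by (auto simp: QR_simps)
  have q_R: "q r \<in> carrier QR" if "r \<in> R" for r
    using that by (simp add: QR_simps)
  have "subgroup ?N F"
  proof (rule F.subgroupI)
    show "?N \<subseteq> carrier F"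
      using R.subset by auto
    have "?P \<one>\<^bsub>F\<^esub> 0 \<one>\<^bsub>Hopf\<^esub>"
      using g.hom_one e.hom_one FA.one_closed FA.l_one [OF FA.one_closed] q.hom_one
        generate.one [of Hopf comm_classes]
      by (simp add: Hopf_simps QR_simps)
    then have "\<one>\<^bsub>F\<^esub> \<in> ?N"
      using R.one_closed by blast
    then show "?N \<noteq> {}"
      by blast
  next
    fix r assume "r \<in> ?N"
    then obtain v C where r: "r \<in> R" and P: "?P r v C"
      by blast
    have "q (inv\<^bsub>F\<^esub> r) = inv\<^bsub>QR\<^esub> q r"
    proof (rule QR.inv_equality [symmetric])
      show "q (inv\<^bsub>F\<^esub> r) \<otimes>\<^bsub>QR\<^esub> q r = \<one>\<^bsub>QR\<^esub>"
        using q_mult [OF R.m_inv_closed [OF r] r] R.mem_carrier [OF r] q.hom_one by (simp add: QR_simps)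
    qed (intro q_R R.m_inv_closed r)+
    then have "?P (inv\<^bsub>F\<^esub> r) (inv\<^bsub>free_Abelian_group {1..n}\<^esub> v) (inv\<^bsub>Hopf\<^esub> C)"
      using P r gen R.mem_carrier [OF r] inv_eq Hopf.generate_m_inv_closed [OF comm_classes_carrier]
      by (simp add: QR.inv_mult FA.inv_mult)
    then show "inv\<^bsub>F\<^esub> r \<in> ?N"
      using r R.m_inv_closed by blast
  next
    fix r s assume "r \<in> ?N" "s \<in> ?N"
    then obtain v C w E where r: "r \<in> R" and P: "?P r v C" and s: "s \<in> R" and P': "?P s w E"
      by blast
    have CE: "C \<otimes>\<^bsub>QR\<^esub> E \<in> generate Hopf comm_classes"
      using P P' generate.eng [of C Hopf comm_classes E] by (simp add: Hopf_simps QR_simps)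
    have "?P (r \<otimes>\<^bsub>F\<^esub> s) (v \<otimes>\<^bsub>free_Abelian_group {1..n}\<^esub> w) (C \<otimes>\<^bsub>QR\<^esub> E)"
      using P P' r s gen CE R.mem_carrier [OF r] R.mem_carrier [OF s] q_mult [OF r s]
      by (simp add: QR.m_ac FA.m_ac)
    then show "r \<otimes>\<^bsub>F\<^esub> s \<in> ?N"
      using r s R.m_closed by blast
  qed
  moreover have "f \<otimes>\<^bsub>F\<^esub> r \<otimes>\<^bsub>F\<^esub> inv\<^bsub>F\<^esub> f \<in> ?N" if f: "f \<in> carrier F" and "r \<in> ?N" for f r
  proof -
    from that obtain v C where r: "r \<in> R" and P: "?P r v C"
      by blast
    have rc: "r \<in> carrier F"
      using r by (rule R.mem_carrier)
    \<comment> \<open>The same v and C serve for a conjugate: \<open>q r\<close> is central and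
      \<open>expo\<close> has a commutative target.\<close>
    have "q (f \<otimes>\<^bsub>F\<^esub> r \<otimes>\<^bsub>F\<^esub> inv\<^bsub>F\<^esub> f) = q r"
      using f rc by (simp add: q_central [OF r, symmetric] q.H.m_assoc)
    moreover have "expo (f \<otimes>\<^bsub>F\<^esub> r \<otimes>\<^bsub>F\<^esub> inv\<^bsub>F\<^esub> f) = expo r"
      using f rc by (simp add: FA.m_comm [of "expo f" "expo r"] FA.m_assoc del: one_free_Abelian_group)
    ultimately have "?P (f \<otimes>\<^bsub>F\<^esub> r \<otimes>\<^bsub>F\<^esub> inv\<^bsub>F\<^esub> f) v C"
      using P by simp
    then show ?thesis
      using R.inv_op_closed2 [OF f r] by blast
  qed
  ultimately have "?N \<lhd> F"
    using F.normal_inv_iff by blast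
  moreover have "sq i \<in> ?N" if i: "i \<in> {1..n}" for i
  proof -
    have "sq i = free_gen i \<otimes>\<^bsub>F\<^esub> free_gen i"
      using gen_carrier [OF i] by (simp add: sq_def numeral_2_eq_2)
    then have "expo (sq i) = frag_of i \<otimes>\<^bsub>free_Abelian_group {1..n}\<^esub> frag_of i"
      using gen_carrier [OF i] expo_gen [OF i] by simp
    moreover have "sq i \<in> R"
      using relators_R relators i by auto
    moreover have "frag_of i \<in> carrier (free_Abelian_group {1..n})"
      using i by (simp add: carrier_free_Abelian_group_iff)
    moreover have "q (sq i) = g (frag_of i) \<otimes>\<^bsub>QR\<^esub> \<one>\<^bsub>Hopf\<^esub>"
      using i g(2) sq_carrier by (simp add: QR_simps Hopf_simps del: atLeastAtMost_iff)
    ultimately have "sq i \<in> R" "?P (sq i) (frag_of i) \<one>\<^bsub>Hopf\<^esub>"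
      by (auto simp: generate.one)
    then show ?thesis
      by blast
  qed
  moreover have "braid i j \<in> ?N" if ij: "(i, j) \<in> finite_pairs n m" for i j
  proof -
    have c: "free_gen i \<in> carrier F" "free_gen j \<in> carrier F"
      using finite_pairs_gens [OF ij] by auto
    \<comment> \<open>Evenness at work: both sides of the relation of a pair contain each generator
      equally often, so its relator contributes v = 0.\<close>
    have "expo (free_gen i \<otimes>\<^bsub>F\<^esub> free_gen j) = expo (free_gen j \<otimes>\<^bsub>F\<^esub> free_gen i)"
      using c by (simp add: FA.m_comm)
    moreover have "expo (a [^]\<^bsub>F\<^esub> k \<otimes>\<^bsub>F\<^esub> inv\<^bsub>F\<^esub> (b [^]\<^bsub>F\<^esub> k)) = \<one>\<^bsub>free_Abelian_group {1..n}\<^esub>"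
      if "a \<in> carrier F" "b \<in> carrier F" "expo a = expo b" for a b and k :: nat
      using that by (simp add: e.hom_nat_pow del: pow_free_Abelian_group)
    ultimately have "expo (braid i j) = \<one>\<^bsub>free_Abelian_group {1..n}\<^esub>"
      using c by (simp add: braid_def del: e.hom_mult one_free_Abelian_group)
    moreover have "q (braid i j) = g 0 \<otimes>\<^bsub>QR\<^esub> q (comm_pow i j)"
      using g.hom_one q_comm_pow [OF ij] q_R [OF braid_R [OF ij]] by simp
    moreover have "q (comm_pow i j) \<in> generate Hopf comm_classes"
      by (rule generate.incl) (use ij in \<open>auto simp: comm_classes_def\<close>)
    ultimately have "?P (braid i j) 0 (q (comm_pow i j))"
      using FA.one_closed FA.l_one [OF FA.one_closed] by simp
    then show ?thesis
      using braid_R [OF ij] by blast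
  qed
  ultimately have "R \<subseteq> ?N"
    by (intro R_minimal) (auto simp: relators)
  then show ?thesis
    using assms(3) by (auto simp: QR_simps mult_free_Abelian_group carrier_free_Abelian_group_iff)
qed

lemma carrier_Hopf_generate: "carrier Hopf = generate Hopf comm_classes"
proof
  show "generate Hopf comm_classes \<subseteq> carrier Hopf"
    using Hopf.generate_in_carrier [OF comm_classes_carrier] by blast
  show "carrier Hopf \<subseteq> generate Hopf comm_classes"
  proof
    fix x assume "x \<in> carrier Hopf"
    then obtain r where r: "r \<in> R" "r \<in> D" "x = q r"
      by (auto simp: Hopf_simps)
    have "(\<lambda>i. q (sq i)) ` {1..n} \<subseteq> carrier QR"
      using relators_R relators by (auto simp: QR_simps)
    from QR.free_Abelian_group_universal [OF this] obtain g where
      g: "g \<in> hom (free_Abelian_group {1..n}) QR" "\<And>i. i \<in> {1..n} \<Longrightarrow> g (frag_of i) = q (sq i)"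
      by blast
    from R_decomposition [OF g r(1)] obtain v C where
      v: "C \<in> generate Hopf comm_classes" "q r = g v \<otimes>\<^bsub>Q\<^esub> C" "expo r = v + v"
      by blast
    have "expo r = 0"
      using F.hom_commutator_trivial [OF expo_hom abelian_free_Abelian_group r(2) [unfolded D_def]] by simp
    then have "v + v = 0"
      using v by simp
    \<comment> \<open>The coefficients are integers, hence without 2-torsion. With v = 0 the part
      generated by the squares disappears.\<close>
    have "v = 0"
    proof (rule poly_mapping_eqI)
      fix i
      have "poly_mapping.lookup v i + poly_mapping.lookup v i = 0"
        using \<open>v + v = 0\<close> by (metis lookup_add lookup_zero)
      then show "poly_mapping.lookup v i = poly_mapping.lookup 0 i"
        by simp
    qed
    moreover have "g 0 = \<one>\<^bsub>Q\<^esub>"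
      using hom_one [OF g(1)] QR.is_group by (simp add: QR_simps)
    moreover have "C \<in> carrier Q"
      using Hopf.generate_in_carrier [OF comm_classes_carrier v(1)] R.subset by (auto simp: Hopf_simps)
    ultimately show "x \<in> generate Hopf comm_classes"
      using v r by simp
  qed
qed

text \<open>In a commutative group the elements of order at most 2 form a subgroup; here it contains
  the generators.\<close>

lemma elementary_Hopf: "elementary_abelian_2_group Hopf"
proof -
  let ?N = "{x \<in> carrier Hopf. x \<otimes>\<^bsub>Hopf\<^esub> x = \<one>\<^bsub>Hopf\<^esub>}"
  have "subgroup ?N Hopf"
  proof (rule Hopf.subgroupI)
    show "?N \<noteq> {}"
      using Hopf.one_closed Hopf.l_one by blast
  next
    fix x assume "x \<in> ?N"
    then show "inv\<^bsub>Hopf\<^esub> x \<in> ?N"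
      by (auto simp flip: Hopf.inv_mult)
  next
    fix x y assume "x \<in> ?N" "y \<in> ?N"
    then have "x \<otimes>\<^bsub>Hopf\<^esub> y \<otimes>\<^bsub>Hopf\<^esub> (x \<otimes>\<^bsub>Hopf\<^esub> y) = (x \<otimes>\<^bsub>Hopf\<^esub> x) \<otimes>\<^bsub>Hopf\<^esub> (y \<otimes>\<^bsub>Hopf\<^esub> y)"
      by (simp add: Hopf.m_ac)
    with \<open>x \<in> ?N\<close> \<open>y \<in> ?N\<close> show "x \<otimes>\<^bsub>Hopf\<^esub> y \<in> ?N"
      by simp
  qed auto
  moreover have "comm_classes \<subseteq> ?N"
    using comm_classes_carrier q_comm_pow_square by (auto simp: comm_classes_def Hopf_simps)
  ultimately have "generate Hopf comm_classes \<subseteq> ?N"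
    by (rule Hopf.generate_subgroup_incl [rotated])
  then show ?thesis
    using comm_group_Hopf carrier_Hopf_generate by (auto simp: elementary_abelian_2_group_def)
qed

lemma bit_span_comm_classes: "bit_span Hopf comm_classes = carrier Hopf"
proof
  show "bit_span Hopf comm_classes \<subseteq> carrier Hopf"
    using comm_classes_carrier Hopf.bit_lincomb_closed unfolding bit_span_def by blast
  show "carrier Hopf \<subseteq> bit_span Hopf comm_classes"
    using Hopf.generate_subset_bit_span [OF elementary_Hopf comm_classes_carrier] carrier_Hopf_generate
    by simp
qed

end

subsection \<open>The classes are independent\<close>

text \<open>The homomorphism to the infinite dihedral group that retracts onto the two generators \<open>k\<close> and \<open>l\<close>
  sends \<open>R\<close> into the rotations by multiples of \<open>2 h\<close> and \<open>[F, R]\<close> into those by multiples of \<open>4 h\<close>.\<close>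

locale even_coxeter_pair = even_coxeter +
  fixes k l h
  assumes kl: "(k, l) \<in> finite_pairs n m"
  defines "h \<equiv> half_exp m k l"
begin

text \<open>The reflections z -> - z and z -> 1 - z, whose two products are the translations by -1
  and 1.\<close>

definition refl :: "nat \<Rightarrow> int \<times> bool" where
  "refl i = (if i = k then (0, True) else if i = l then (1, True) else (0, False))"

definition \<phi> where "\<phi> = free_lift dihedral refl"

sublocale \<phi>: group_hom F dihedral \<phi>
proof -
  have "\<phi> \<in> hom F dihedral"
    unfolding \<phi>_def F_eq by (rule group.free_lift_hom [OF group_dihedral]) auto
  then show "group_hom F dihedral \<phi>"
    by (simp add: group_hom_def group_hom_axioms_def group_dihedral F.is_group)
qed

lemma \<phi>_gen: "\<phi> (free_gen i) = refl i"
  unfolding \<phi>_def by (rule group.free_lift_free_gen [OF group_dihedral]) simp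

lemma k_neq_l: "k \<noteq> l"
  using finite_pairs_bounds [OF kl] by simp

lemma h_pos: "h > 0"
  using half_exp_pos [OF kl] by (simp add: h_def)

lemma \<phi>_sq: "i \<in> {1..n} \<Longrightarrow> \<phi> (sq i) = (0, False)"
  using gen_carrier [of i] by (simp add: sq_def numeral_2_eq_2 \<phi>_gen refl_def)

text \<open>As i < j and k < l, a different pair has an index outside {k, l}, and the generator of
  that index is sent to 1.\<close>

lemma refl_one:
  assumes "(i, j) \<in> finite_pairs n m" "(i, j) \<noteq> (k, l)"
  shows "refl i = \<one>\<^bsub>dihedral\<^esub> \<or> refl j = \<one>\<^bsub>dihedral\<^esub>"
  using assms finite_pairs_bounds [OF assms(1)] finite_pairs_bounds [OF kl]
  by (auto simp: refl_def one_dihedral)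

text \<open>For \<open>(k, l)\<close> the two products of reflections are translations by -1 and 1,
  so their powers differ by - h - h. For any other pair one factor is trivial and the two products
  coincide.\<close>

lemma \<phi>_braid:
  assumes ij: "(i, j) \<in> finite_pairs n m"
  shows "\<phi> (braid i j) = (if (i, j) = (k, l) then - 2 * int h else 0, False)"
proof -
  have c: "free_gen i \<in> carrier F" "free_gen j \<in> carrier F"
    using finite_pairs_gens [OF ij] by auto
  have eq: "\<phi> (braid i j) = (refl i \<otimes>\<^bsub>dihedral\<^esub> refl j) [^]\<^bsub>dihedral\<^esub> half_exp m i j
      \<otimes>\<^bsub>dihedral\<^esub> inv\<^bsub>dihedral\<^esub> ((refl j \<otimes>\<^bsub>dihedral\<^esub> refl i) [^]\<^bsub>dihedral\<^esub> half_exp m i j)"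
    using c by (simp add: braid_def \<phi>.hom_nat_pow \<phi>_gen)
  show ?thesis
  proof (cases "(i, j) = (k, l)")
    case True
    then show ?thesis
      using k_neq_l eq by (simp add: refl_def h_def)
  next
    case False
    then have "refl i \<otimes>\<^bsub>dihedral\<^esub> refl j = refl j \<otimes>\<^bsub>dihedral\<^esub> refl i"
      using refl_one [OF ij] by auto
    then show ?thesis
      using False eq by (auto simp: one_dihedral [symmetric])
  qed
qed

lemma \<phi>_comm_pow:
  assumes ij: "(i, j) \<in> finite_pairs n m"
  shows "\<phi> (comm_pow i j) = (if (i, j) = (k, l) then - 2 * int h else 0, False)"
proof -
  have c: "free_gen i \<in> carrier F" "free_gen j \<in> carrier F"
    using finite_pairs_gens [OF ij] by auto
  have eq: "\<phi> (comm_pow i j) = group_commutator dihedral (refl i) (refl j) [^]\<^bsub>dihedral\<^esub> half_exp m i j"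
    using c by (simp add: comm_pow_def \<phi>.hom_nat_pow \<phi>.hom_group_commutator \<phi>_gen F.group_commutator_closed)
  show ?thesis
  proof (cases "(i, j) = (k, l)")
    case True
    then show ?thesis
      using k_neq_l eq by (simp add: group_commutator_def refl_def h_def)
  next
    case False
    then have "group_commutator dihedral (refl i) (refl j) = \<one>\<^bsub>dihedral\<^esub>"
      using refl_one [OF ij] by (auto simp: \<phi>.H.group_commutator_eq_one_iff)
    then show ?thesis
      using False eq by (auto simp: one_dihedral [symmetric])
  qed
qed

text \<open>Conjugation changes at most the sign of a translation. Used with c = 2h for R and c = 4h
  for [F,R].\<close>

lemma normal_rotations: "{f \<in> carrier F. \<exists>z. \<phi> f = (c * z, False)} \<lhd> F" (is "?N \<lhd> F")
proof -
  have "subgroup ?N F"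
  proof (rule F.subgroupI)
    have "\<phi> \<one>\<^bsub>F\<^esub> = (c * 0, False)"
      by (simp add: one_dihedral)
    then have "\<one>\<^bsub>F\<^esub> \<in> ?N"
      by blast
    then show "?N \<noteq> {}"
      by blast
  next
    fix f assume "f \<in> ?N"
    then obtain z where "f \<in> carrier F" "\<phi> f = (c * z, False)"
      by blast
    then have "inv\<^bsub>F\<^esub> f \<in> carrier F" "\<phi> (inv\<^bsub>F\<^esub> f) = (c * - z, False)"
      by auto
    then show "inv\<^bsub>F\<^esub> f \<in> ?N"
      by blast
  next
    fix f g assume "f \<in> ?N" "g \<in> ?N"
    then obtain z w where "f \<in> carrier F" "\<phi> f = (c * z, False)" "g \<in> carrier F" "\<phi> g = (c * w, False)"
      by blast
    then have "f \<otimes>\<^bsub>F\<^esub> g \<in> carrier F" "\<phi> (f \<otimes>\<^bsub>F\<^esub> g) = (c * (z + w), False)"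
      by (auto simp: algebra_simps)
    then show "f \<otimes>\<^bsub>F\<^esub> g \<in> ?N"
      by blast
  qed auto
  moreover have "f \<otimes>\<^bsub>F\<^esub> r \<otimes>\<^bsub>F\<^esub> inv\<^bsub>F\<^esub> f \<in> ?N" if f: "f \<in> carrier F" and "r \<in> ?N" for f r
  proof -
    from that obtain z where r: "r \<in> carrier F" "\<phi> r = (c * z, False)"
      by blast
    obtain a e where "\<phi> f = (a, e)"
      by fastforce
    then have "\<phi> (f \<otimes>\<^bsub>F\<^esub> r \<otimes>\<^bsub>F\<^esub> inv\<^bsub>F\<^esub> f) = (c * (if e then - z else z), False)"
      using f r by auto
    then show ?thesis
      using f r by blast
  qed
  ultimately show ?thesis
    using F.normal_inv_iff by blast
qed

lemma \<phi>_R: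
  assumes "r \<in> R"
  shows "\<exists>z. \<phi> r = (2 * int h * z, False)"
proof -
  let ?N = "{f \<in> carrier F. \<exists>z. \<phi> f = (2 * int h * z, False)}"
  have "sq i \<in> ?N" if "i \<in> {1..n}" for i
    using that sq_carrier \<phi>_sq by auto
  moreover have "braid i j \<in> ?N" if "(i, j) \<in> finite_pairs n m" for i j
  proof -
    have "\<phi> (braid i j) = (2 * int h * (if (i, j) = (k, l) then - 1 else 0), False)"
      using \<phi>_braid [OF that] by simp
    then show ?thesis
      using braid_carrier [OF that] by blast
  qed
  ultimately have "even_coxeter_relators n m \<subseteq> ?N"
    unfolding relators by (intro Un_least image_subsetI) auto
  then show ?thesis
    using R_minimal [OF normal_rotations] assms by blast
qed

lemma \<phi>_K:
  assumes "x \<in> K"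
  shows "\<exists>z. \<phi> x = (4 * int h * z, False)"
proof -
  let ?N = "{f \<in> carrier F. \<exists>z. \<phi> f = (4 * int h * z, False)}"
  have "K \<subseteq> ?N"
    unfolding K_def
  proof (rule F.commutator_subgroup_minimal [OF normal_imp_subgroup [OF normal_rotations]])
    fix f r assume f: "f \<in> carrier F" and r: "r \<in> R"
    have rc: "r \<in> carrier F"
      using r by (rule R.mem_carrier)
    obtain z where z: "\<phi> r = (2 * int h * z, False)"
      using \<phi>_R [OF r] by blast
    obtain a e where "\<phi> f = (a, e)"
      by fastforce
    \<comment> \<open>If f goes to a translation the commutator is trivial; if f goes to a
      reflection, it is the inverse square of the image of r, which doubles 2h to 4h.\<close>
    then have "\<phi> (group_commutator F f r) = (4 * int h * (if e then - z else 0), False)"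
      using f rc z by (auto simp: \<phi>.hom_group_commutator group_commutator_def)
    then show "group_commutator F f r \<in> ?N"
      using f rc F.group_commutator_closed by blast
  qed
  then show ?thesis
    using assms by blast
qed

text \<open>\<open>\<phi>\<close> lives on F, and on Q its value is determined only modulo 4h. Hence
  a representative is carried along, and only the coefficient of the class of \<open>(k, l)\<close>
  is visible modulo 4h.\<close>

lemma bit_lincomb_\<phi>:
  assumes "finite T" "T \<subseteq> comm_classes"
  shows "\<exists>g\<in>R \<inter> D. bit_lincomb Hopf T c = q g \<and> (\<exists>z. \<phi> g =
     (2 * int h * (if q (comm_pow k l) \<in> T \<and> c (q (comm_pow k l)) = 1 then 1 else 0) + 4 * int h * z, False))"
  using assms
proof (induction T)
  case empty
  have "\<phi> \<one>\<^bsub>F\<^esub> = (4 * int h * 0, False)"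
    by (simp add: one_dihedral)
  then show ?case
    using R.one_closed subgroup.one_closed [OF subgroup_D]
    by (intro bexI [of _ "\<one>\<^bsub>F\<^esub>"]) (auto simp: bit_lincomb_def Hopf_simps)
next
  case (insert x T)
  let ?d = "\<lambda>T. if q (comm_pow k l) \<in> T \<and> c (q (comm_pow k l)) = 1 then 1 else 0 :: int"
  from insert obtain g z where g: "g \<in> R" "g \<in> D" "bit_lincomb Hopf T c = q g"
    "\<phi> g = (2 * int h * ?d T + 4 * int h * z, False)"
    by blast
  have x: "x \<in> carrier Hopf" "T \<subseteq> carrier Hopf"
    using insert comm_classes_carrier by auto
  have "bit_lincomb Hopf (insert x T) c = bit_scale Hopf (c x) x \<otimes>\<^bsub>Hopf\<^esub> q g"
    using insert x unfolding g(3) [symmetric] bit_lincomb_def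
    by (intro Hopf.finprod_insert) (auto intro!: Hopf.bit_scale_closed)
  show ?case
  proof (cases "c x = 1")
    case False
    then have d: "?d (insert x T) = ?d T"
      by auto
    have "\<phi> g = (2 * int h * ?d (insert x T) + 4 * int h * z, False)"
      unfolding d by (rule g(4))
    moreover have "bit_lincomb Hopf (insert x T) c = q g"
      unfolding \<open>bit_lincomb Hopf (insert x T) c = _\<close> using False g by (simp add: bit_scale_def Hopf_simps R.mem_carrier)
    ultimately show ?thesis
      using g(1,2) by blast
  next
    case True
    \<comment> \<open>The class x could have several indices, as injectivity is not yet known; if
      \<open>(k, l)\<close> is among them, it must be the one chosen.\<close>
    obtain i j where ij: "(i, j) \<in> finite_pairs n m" "x = q (comm_pow i j)"
      and ij_kl: "x = q (comm_pow k l) \<Longrightarrow> (i, j) = (k, l)"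
    proof (cases "x = q (comm_pow k l)")
      case True
      then show ?thesis
        using that kl by blast
    next
      case False
      then show ?thesis
        using that insert.prems by (auto simp: comm_classes_def)
    qed
    let ?g = "comm_pow i j \<otimes>\<^bsub>F\<^esub> g"
    have gc: "g \<in> carrier F" "comm_pow i j \<in> carrier F"
      using g ij R.mem_carrier comm_pow_carrier by auto
    have "?g \<in> R" "?g \<in> D"
      using g ij comm_pow_R comm_pow_D by (auto intro: R.m_closed subgroup.m_closed [OF subgroup_D])
    moreover have "bit_lincomb Hopf (insert x T) c = q ?g"
      unfolding \<open>bit_lincomb Hopf (insert x T) c = _\<close> using True gc ij by (simp add: bit_scale_def Hopf_simps)
    moreover have "\<exists>z. \<phi> ?g = (2 * int h * ?d (insert x T) + 4 * int h * z, False)"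
    proof (cases "(i, j) = (k, l)")
      case True
      then have "?d (insert x T) = 1" "?d T = 0"
        using ij \<open>c x = 1\<close> insert.hyps by auto
      \<comment> \<open>The class contributes -2h = 2h - 4h, which gives the witness z - 1
        below.\<close>
      moreover have "\<phi> ?g = (- 2 * int h + 4 * int h * z, False)"
        using True gc g(4) \<open>?d T = 0\<close> \<phi>_comm_pow [OF ij(1)] by simp
      ultimately show ?thesis
        by (intro exI [of _ "z - 1"]) (simp add: algebra_simps)
    next
      case False
      then have d: "?d (insert x T) = ?d T"
        using ij_kl by auto
      have "\<phi> ?g = \<phi> g"
        using False gc g(4) \<phi>_comm_pow [OF ij(1)] by auto
      then show ?thesis
        unfolding d g(4) by blast
    qed
    ultimately show ?thesis
      by blast
  qed
qed

text \<open>A nonzero coefficient would make an odd multiple of 2h a multiple of 4h.\<close>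

lemma bit_lincomb_one:
  assumes "finite T" "T \<subseteq> comm_classes" "bit_lincomb Hopf T c = \<one>\<^bsub>Hopf\<^esub>" "q (comm_pow k l) \<in> T"
  shows "c (q (comm_pow k l)) = 0"
proof (rule ccontr)
  assume "c (q (comm_pow k l)) \<noteq> 0"
  then have "c (q (comm_pow k l)) = 1"
    by simp
  then obtain g z where g: "g \<in> R" "bit_lincomb Hopf T c = q g" "\<phi> g = (2 * int h + 4 * int h * z, False)"
    using bit_lincomb_\<phi> [OF assms(1,2), of c] assms(4) by auto
  then have "g \<in> K"
    using assms(3) q_eq_one_iff [of g] by (simp add: Hopf_simps R.mem_carrier)
  then obtain w where "\<phi> g = (4 * int h * w, False)"
    using \<phi>_K by blast
  then have "2 * int h * (1 + 2 * z) = 2 * int h * (2 * w)"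
    using g by (simp add: algebra_simps)
  then have "1 + 2 * z = 2 * w"
    using h_pos by simp
  then show False
    by presburger
qed

text \<open>The quotient of the two elements is sent to the translation by 2h, which is not a
  multiple of 4h. Independence concerns the set of classes; that distinct pairs give distinct
  classes is this separate fact.\<close>

lemma class_inj:
  assumes ij: "(i, j) \<in> finite_pairs n m" and eq: "q (comm_pow i j) = q (comm_pow k l)"
  shows "(i, j) = (k, l)"
proof (rule ccontr)
  assume ne: "(i, j) \<noteq> (k, l)"
  have c: "comm_pow i j \<in> carrier F" "comm_pow k l \<in> carrier F"
    using ij kl comm_pow_carrier by auto
  then have "comm_pow i j \<otimes>\<^bsub>F\<^esub> inv\<^bsub>F\<^esub> comm_pow k l \<in> K"
    using eq q_eq_iff by blast
  then obtain w where "\<phi> (comm_pow i j \<otimes>\<^bsub>F\<^esub> inv\<^bsub>F\<^esub> comm_pow k l) = (4 * int h * w, False)"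
    using \<phi>_K by blast
  then have "2 * int h * 1 = 2 * int h * (2 * w)"
    using c ne \<phi>_comm_pow [OF ij] \<phi>_comm_pow [OF kl] by auto
  then have "1 = 2 * w"
    using h_pos by (subst (asm) mult_left_cancel) auto
  then show False
    by presburger
qed

end

theorem theorem7p1:
  fixes n :: nat and m :: "nat \<Rightarrow> nat \<Rightarrow> enat"
  assumes "n \<ge> 1" and "even_coxeter_matrix n m"
  shows "integral_homology 2 (even_coxeter_group n m)
           \<cong> hopf_group (coxeter_free n) (even_coxeter_kernel n m)
       \<and> elementary_abelian_2_group (hopf_group (coxeter_free n) (even_coxeter_kernel n m))
       \<and> inj_on (commutator_power_class n m) (finite_pairs n m)
       \<and> bit_basis (hopf_group (coxeter_free n) (even_coxeter_kernel n m))
           (commutator_power_class n m ` finite_pairs n m)"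
proof -
  interpret even_coxeter n m
    by unfold_locales fact
  have pair: "even_coxeter_pair n m k l" if "(k, l) \<in> finite_pairs n m" for k l
    by unfold_locales fact
  have Hopf: "hopf_group (coxeter_free n) (even_coxeter_kernel n m) = Hopf"
    using hopf_group_eq by (simp add: F_def R_def)
  have "integral_homology 2 (even_coxeter_group n m) \<cong> Hopf"
    using free_group_hopf_formula [of R "{1..n}"] R_normal hopf_group_eq
    by (simp add: even_coxeter_group_def F_def R_def coxeter_free_def)
  moreover have "inj_on (commutator_power_class n m) (finite_pairs n m)"
    unfolding commutator_power_class_eq
    using even_coxeter_pair.class_inj [OF pair] by (fastforce intro!: inj_onI)
  moreover have "bit_basis Hopf comm_classes"
    unfolding bit_basis_def bit_independent_def
  proof (intro conjI allI impI ballI comm_classes_carrier bit_span_comm_classes)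
    fix T c x assume T: "finite T \<and> T \<subseteq> comm_classes" "bit_lincomb Hopf T c = \<one>\<^bsub>Hopf\<^esub>" "x \<in> T"
    then obtain k l where "(k, l) \<in> finite_pairs n m" "x = q (comm_pow k l)"
      by (auto simp: comm_classes_def)
    \<comment> \<open>Each coefficient is tested with the dihedral map belonging to its own
      pair.\<close>
    then show "c x = 0"
      using even_coxeter_pair.bit_lincomb_one [OF pair] T by blast
  qed
  ultimately show ?thesis
    unfolding Hopf commutator_power_class_eq using elementary_Hopf by (simp add: comm_classes_def)
qed

end
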